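(* For any $\epsilon>0$ there exists a constant $c=c(\epsilon)$ such that for all real $H,D>0$ the number $N(H,D)$ of cubic polynomials $P$ with integer coefficients satisfying $H(P)\le H$ and $0<|D(P)|\le D$ is bounded from above by $$N(H,D)\le c\,H^{2/3+\epsilon}D^{5/6}.$$
   Context: $H(P)$ denotes the naive height of the polynomial $P$, i.e. the maximum of the absolute values of its coefficients, and $D(P)$ denotes the discriminant of $P$. *)

theory Defs
  imports Complex_Main "Subresultants.Resultant_Prelim"
begin

definition height :: "int poly \<Rightarrow> int" where
  "height P = (MAX i\<in>{..degree P}. \<bar>coeff P i\<bar>)"

(* D(P) = (-1)^(n(n-1)/2) Res(P, P') / a_n for P of degree n with leading coefficient a_n;
   the division is exact because the first column of the Sylvester matrix is divisible by a_n. *)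
definition discriminant :: "int poly \<Rightarrow> int" where
  "discriminant P =
     (-1) ^ (degree P * (degree P - 1) div 2) * (resultant P (pderiv P) div lead_coeff P)"

definition cubics :: "real \<Rightarrow> real \<Rightarrow> int poly set" where
  "cubics H D =
     {P. degree P = 3 \<and> real_of_int (height P) \<le> H \<and>
         0 < \<bar>discriminant P\<bar> \<and> real_of_int \<bar>discriminant P\<bar> \<le> D}"

definition N :: "real \<Rightarrow> real \<Rightarrow> nat" where
  "N H D = card (cubics H D)"

(* The set counted by N is finite, so N never takes the junk value of card on infinite sets. *)
lemma finite_cubics: "finite (cubics H D)"
proof (rule finite_subset)
  let ?S = "{- \<lfloor>H\<rfloor>..\<lfloor>H\<rfloor>}"
  let ?L = "{xs. set xs \<subseteq> ?S \<and> length xs = 4}"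
  show "cubics H D \<subseteq> Poly ` ?L"
  proof
    fix P assume "P \<in> cubics H D"
    then have deg: "degree P = 3" and ht: "real_of_int (height P) \<le> H"
      by (auto simp: cubics_def)
    have "\<bar>coeff P i\<bar> \<le> \<lfloor>H\<rfloor>" if "i \<le> 3" for i
    proof -
      have "\<bar>coeff P i\<bar> \<le> height P"
        unfolding height_def using that deg by (intro Max_ge) auto
      then show ?thesis using ht by linarith
    qed
    then have "coeff P i \<in> ?S" if "i \<le> 3" for i
      using that by (force simp: abs_le_iff)
    then have "set (coeffs P) \<subseteq> ?S"
      using deg by (auto simp: coeffs_def)
    moreover have "length (coeffs P) = 4"
      using deg by (auto simp: coeffs_def)
    ultimately show "P \<in> Poly ` ?L"
      by (metis (mono_tags, lifting) Poly_coeffs image_eqI mem_Collect_eq)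
  qed
  show "finite (Poly ` ?L)"
    by (intro finite_imageI finite_lists_length_eq) auto
qed

lemma det_rows_Suc:
  fixes R :: "'a::comm_ring_1 list list"
  assumes "length R = Suc n" "\<forall>r\<in>set R. length r = Suc n"
  shows "det (mat (Suc n) (Suc n) (\<lambda>(i, j). R ! i ! j)) =
    (\<Sum>i<Suc n. R ! i ! 0 * ((-1) ^ i *
       det (mat n n (\<lambda>(k, j). map tl (take i R @ drop (Suc i) R) ! k ! j))))"
proof -
  let ?A = "mat (Suc n) (Suc n) (\<lambda>(i, j). R ! i ! j)"
  have "det ?A = (\<Sum>i<Suc n. ?A $$ (i, 0) * cofactor ?A i 0)"
    by (rule laplace_expansion_column) auto
  also have "\<dots> = (\<Sum>i<Suc n. R ! i ! 0 * ((-1) ^ i *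
       det (mat n n (\<lambda>(k, j). map tl (take i R @ drop (Suc i) R) ! k ! j))))"
  proof (rule sum.cong)
    fix i assume i: "i \<in> {..<Suc n}"
    have "mat_delete ?A i 0 = mat n n (\<lambda>(k, j). map tl (take i R @ drop (Suc i) R) ! k ! j)"
      using i assms by (intro eq_matI) (auto simp: mat_delete_def nth_append nth_tl)
    with i show "?A $$ (i, 0) * cofactor ?A i 0 = R ! i ! 0 * ((-1) ^ i *
       det (mat n n (\<lambda>(k, j). map tl (take i R @ drop (Suc i) R) ! k ! j)))"
      by (simp add: cofactor_def)
  qed simp
  finally show ?thesis .
qed

lemma det_mat_1: "det (mat (Suc 0) (Suc 0) (\<lambda>(i, j). R ! i ! j)) = (R ! 0 ! 0 :: 'a::comm_ring_1)"
  by (subst det_single) auto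

lemma discriminant_cubic:
  fixes a b c d :: int
  assumes "a \<noteq> 0"
  shows "discriminant [:d, c, b, a:] =
    b^2 * c^2 - 4 * a * c^3 - 4 * b^3 * d - 27 * a^2 * d^2 + 18 * a * b * c * d"
    (is "_ = ?D")
proof -
  let ?P = "[:d, c, b, a:]"
  let ?R = "[[a, b, c, d, 0], [0, a, b, c, d], [3*a, 2*b, c, 0, 0],
             [0, 3*a, 2*b, c, 0], [0, 0, 3*a, 2*b, c]]"
  have pd: "pderiv ?P = [:c, 2*b, 3*a:]"
    by (simp add: pderiv_pCons)
  have "sylvester_mat ?P (pderiv ?P) =
      mat (Suc (Suc (Suc (Suc (Suc 0))))) (Suc (Suc (Suc (Suc (Suc 0))))) (\<lambda>(i, j). ?R ! i ! j)"
    unfolding pd sylvester_mat_def sylvester_mat_sub_def using assms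
    by (intro eq_matI) (auto simp: less_Suc_eq numeral_eq_Suc)
  then have "resultant ?P (pderiv ?P) = det
      (mat (Suc (Suc (Suc (Suc (Suc 0))))) (Suc (Suc (Suc (Suc (Suc 0))))) (\<lambda>(i, j). ?R ! i ! j))"
    by (simp add: resultant_def)
  also have "\<dots> = a * (- ?D)"
    by (simp add: det_rows_Suc det_mat_1 lessThan_Suc)
      (simp add: algebra_simps power2_eq_square power3_eq_cube)
  finally have "resultant ?P (pderiv ?P) = a * (- ?D)" .
  moreover have "degree ?P = 3" "lead_coeff ?P = a"
    using assms by simp_all
  ultimately show ?thesis
    unfolding discriminant_def using assms by (simp del: mult_minus_right)
qed

end

(* Factor a cubic form F of discriminant D <> 0 over the complex numbers into linear forms
   L_0, L_1, L_2, scaled so that all determinants |det(L_i, L_j)| equal k = |D|^(1/6).  The quadratic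
   form |L_0|^2 + |L_1|^2 + |L_2|^2 is then a real covariant of discriminant -12 k^2.  Reducing it by
   SL_2(Z) gives a representative with |ad|, |bc| << |D|^(1/2) and similar bounds, so the forms of
   discriminant at most D fall into << D (1 + log D)^2 classes.

   It remains to bound, for one form F, the number of g in SL_2(Z) such that F o g has height at
   most H.  If M_i is the largest coefficient of L_i o g, then M_0 M_1 M_2 << H, and the two largest
   of the M_i agree up to a factor 2.  So for M_i of size T the columns of g are primitive integer
   vectors with |L_i| << T and |L_k| << min(T, H / T^2), a region containing
   << T min(T, H / T^2) / k <= H^(2/3) / k of them.  Summing over dyadic T costs a factor log H, and
   D * H^(2/3) * D^(-1/6) = H^(2/3) D^(5/6). *)

theory Submission
  imports Defs "HOL-Computational_Algebra.Fundamental_Theorem_Algebra"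
begin

section \<open>Primitive vectors\<close>

text \<open>The exponent of D carries no epsilon, so the logarithms of D from the class count must
  become logarithms of H. This is possible because a form of height at most H has |D| <= 54 H^4. The
  number of substitutions depends on the discriminant of the single form, not on the upper bound D.
  Hence the count is made in shells D/2 < |disc| <= D, which are summed like a geometric series in
  D^(5/6). The region |L_i| <= A, |L_k| <= B is not compared with its area. Its primitive vectors
  have pairwise determinants at most 2AB/k, and this alone bounds their number. Because the columns
  of g have determinant 1, a single such g forces AB >= k/2, which absorbs the additive constant. A
  reduced representative may have leading coefficient 0 although the counted form does not. So
  factorisations and discriminants are treated for forms, and a representative inherits its
  factorisation from the form that it represents. Several g may lead to the same form; that only
  increases the count.\<close>

definition det2 :: "int \<times> int \<Rightarrow> int \<times> int \<Rightarrow> int" where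
  "det2 w z = fst w * snd z - snd w * fst z"

abbreviation primitive :: "int \<times> int \<Rightarrow> bool" where
  "primitive w \<equiv> coprime (fst w) (snd w)"

lemma det2_eq_0_imp_multiple:
  assumes "primitive v" "det2 w v = 0"
  obtains k where "w = (k * fst v, k * snd v)"
proof -
  obtain x y where w: "w = (x, y)" by (cases w)
  obtain p q where v: "v = (p, q)" by (cases v)
  from assms have pq: "coprime p q" and e: "x * q = y * p" by (auto simp: w v det2_def)
  obtain s t where st: "s * p + t * q = 1" using pq bezout_int[of p q] by (metis coprime_imp_gcd_eq_1)
  have "(s * x + t * y) * p = s * p * x + t * (y * p)" by (simp add: algebra_simps)
  also have "\<dots> = (s * p + t * q) * x" unfolding e [symmetric] by (simp add: algebra_simps)
  finally have 1: "(s * x + t * y) * p = x" by (simp add: st)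
  have "(s * x + t * y) * q = s * (x * q) + t * q * y" by (simp add: algebra_simps)
  also have "\<dots> = (s * p + t * q) * y" unfolding e by (simp add: algebra_simps)
  finally have 2: "(s * x + t * y) * q = y" by (simp add: st)
  show ?thesis
    by (rule that[of "s * x + t * y"]) (simp only: w v fst_conv snd_conv 1 2)
qed

lemma det2_commute: "det2 w z = - det2 z w"
  by (simp add: det2_def)

text \<open>Relative to a pair \<open>w1\<close>, \<open>w2\<close> of maximal determinant
  \<open>\<delta>\<close>, a vector \<open>z\<close> has the coordinates \<open>det2 w1 z\<close>
  and \<open>det2 z w2\<close>; their ranges alone give a quadratic bound. As \<open>w1\<close> is
  primitive, the first coordinate fixes the second modulo \<open>\<bar>\<delta>\<bar>\<close>, so
  only a quotient among -1, 0, 1 stays free. This leaves 3 (2 |\<delta>| + 1) <= 9 |\<delta>|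
  vectors. The 2 covers \<delta> = 0, where only a vector and its negative fit.\<close>

lemma card_primitive_le:
  fixes S :: "(int \<times> int) set" and \<Delta> :: int
  assumes prim: "\<And>w. w \<in> S \<Longrightarrow> primitive w"
    and "0 \<le> \<Delta>" and bd: "\<And>w z. w \<in> S \<Longrightarrow> z \<in> S \<Longrightarrow> \<bar>det2 w z\<bar> \<le> \<Delta>"
  shows "finite S \<and> int (card S) \<le> 2 + 9 * \<Delta>"
proof (cases "S = {}")
  case False
  define E where "E = (\<lambda>(w, z). \<bar>det2 w z\<bar>) ` (S \<times> S)"
  have fE: "finite E" by (rule finite_subset[of _ "{0..\<Delta>}"]) (auto simp: E_def bd)
  have "E \<noteq> {}" using False by (auto simp: E_def)
  then have "Max E \<in> E" using fE by simp
  then obtain w1 w2 where w: "w1 \<in> S" "w2 \<in> S" "\<bar>det2 w1 w2\<bar> = Max E"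
    by (auto simp: E_def)
  define \<delta> where "\<delta> = det2 w1 w2"
  have mx: "\<bar>det2 w z\<bar> \<le> \<bar>\<delta>\<bar>" if "w \<in> S" "z \<in> S" for w z
    unfolding \<delta>_def w(3) using that by (intro Max_ge fE) (auto simp: E_def)
  have \<Delta>: "\<bar>\<delta>\<bar> \<le> \<Delta>" using bd[OF w(1,2)] by (simp add: \<delta>_def)
  show ?thesis
  proof (cases "\<delta> = 0")
    case True
    have "S \<subseteq> {w1, (- fst w1, - snd w1)}"
    proof
      fix z assume z: "z \<in> S"
      have "det2 z w1 = 0" using mx[OF z w(1)] True by simp
      then obtain k where k: "z = (k * fst w1, k * snd w1)"
        using det2_eq_0_imp_multiple prim[OF w(1)] by blast
      have "k dvd 1" using prim[OF z] k
        by (metis coprime_def dvd_triv_left fst_conv snd_conv)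
      then have "k = 1 \<or> k = -1" by (simp add: zdvd1_eq) linarith
      then show "z \<in> {w1, (- fst w1, - snd w1)}" using k by auto
    qed
    moreover have "card {w1, (- fst w1, - snd w1)} \<le> 2" by (simp add: card_insert_if)
    ultimately have "finite S" "card S \<le> 2"
      by (auto intro: finite_subset order_trans[OF card_mono[of "{w1, (- fst w1, - snd w1)}"]])
    then show ?thesis using \<Delta> by auto
  next
    case False
    define \<phi> where "\<phi> z = (det2 w1 z, det2 z w2 div \<bar>\<delta>\<bar>)" for z
    have id: "\<delta> * fst z = det2 z w2 * fst w1 + det2 w1 z * fst w2"
      "\<delta> * snd z = det2 z w2 * snd w1 + det2 w1 z * snd w2" for z
      by (auto simp: \<delta>_def det2_def algebra_simps)
    have inj: "inj_on \<phi> S"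
    proof (rule inj_onI)
      fix z y assume z: "z \<in> S" and y: "y \<in> S" and e: "\<phi> z = \<phi> y"
      define m where "m = det2 z w2 - det2 y w2"
      have n: "det2 w1 z = det2 w1 y" and q: "det2 z w2 div \<bar>\<delta>\<bar> = det2 y w2 div \<bar>\<delta>\<bar>"
        using e by (auto simp: \<phi>_def)
      have "\<delta> * (fst z - fst y) = m * fst w1" "\<delta> * (snd z - snd y) = m * snd w1"
        using id[of z] id[of y] n by (auto simp: m_def algebra_simps)
      then have "\<delta> dvd m * fst w1" "\<delta> dvd m * snd w1" by (metis dvd_triv_left)+
      then have "\<delta> dvd gcd (m * fst w1) (m * snd w1)" by simp
      also have "gcd (m * fst w1) (m * snd w1) = \<bar>m\<bar>"
        using prim[OF w(1)] by (simp add: gcd_mult_distrib_int[symmetric] coprime_imp_gcd_eq_1)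
      finally have "\<bar>\<delta>\<bar> dvd m" by simp
      then have "det2 z w2 mod \<bar>\<delta>\<bar> = det2 y w2 mod \<bar>\<delta>\<bar>"
        by (simp add: m_def mod_eq_dvd_iff)
      with q have "det2 z w2 = det2 y w2" by (metis div_mult_mod_eq)
      with n False show "z = y" using id[of z] id[of y]
        by (metis mult_left_cancel prod_eqI)
    qed
    have im: "\<phi> ` S \<subseteq> {- \<bar>\<delta>\<bar>..\<bar>\<delta>\<bar>} \<times> {-1..1}"
    proof
      fix x assume "x \<in> \<phi> ` S"
      then obtain z where z: "z \<in> S" "x = \<phi> z" by auto
      have bd1: "\<bar>det2 w1 z\<bar> \<le> \<bar>\<delta>\<bar>" and bd2: "\<bar>det2 z w2\<bar> \<le> \<bar>\<delta>\<bar>"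
        using mx w z(1) by blast+
      have pos: "0 < \<bar>\<delta>\<bar>" using False by simp
      have "det2 z w2 div \<bar>\<delta>\<bar> \<le> (1 * \<bar>\<delta>\<bar>) div \<bar>\<delta>\<bar>"
        using bd2 pos by (intro zdiv_mono1) linarith+
      also have "\<dots> = 1" using pos by (intro nonzero_mult_div_cancel_right) linarith
      finally have up: "det2 z w2 div \<bar>\<delta>\<bar> \<le> 1" .
      have "- 1 = (- 1 * \<bar>\<delta>\<bar>) div \<bar>\<delta>\<bar>"
        using pos by (intro nonzero_mult_div_cancel_right[symmetric]) linarith
      also have "\<dots> \<le> det2 z w2 div \<bar>\<delta>\<bar>" using bd2 pos by (intro zdiv_mono1) linarith+
      finally have "- 1 \<le> det2 z w2 div \<bar>\<delta>\<bar>" .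
      then show "x \<in> {- \<bar>\<delta>\<bar>..\<bar>\<delta>\<bar>} \<times> {- 1..1}"
        using up bd1 by (simp add: z(2) \<phi>_def abs_le_iff)
    qed
    have fin: "finite S" using inj im by (metis finite_SigmaI finite_atLeastAtMost_int finite_imageD finite_subset)
    have "card S \<le> card ({- \<bar>\<delta>\<bar>..\<bar>\<delta>\<bar>} \<times> {-1..1::int})"
      using card_inj_on_le[OF inj im] by simp
    also have "\<dots> = nat (2 * \<bar>\<delta>\<bar> + 1) * 3" by (simp add: card_cartesian_product)
    finally have "int (card S) \<le> (2 * \<bar>\<delta>\<bar> + 1) * 3"
      by (simp flip: of_nat_le_iff[where 'a = int])
    then show ?thesis using fin \<Delta> False by auto
  qed
qed (use assms in simp)

section \<open>Integer points under a hyperbola\<close>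

lemma sum_inverse_le_ln:
  assumes "n \<ge> 1"
  shows "(\<Sum>k=1..n. 1 / real k) \<le> 1 + ln (real n)"
  using assms
proof (induction n rule: nat_induct_at_least)
  case (Suc n)
  have "ln (real n / real (Suc n)) \<le> real n / real (Suc n) - 1"
    using Suc.hyps by (intro ln_le_minus_one) auto
  also have "\<dots> = - (1 / real (Suc n))" by (simp add: field_simps)
  finally have "1 / real (Suc n) \<le> ln (real (Suc n)) - ln (real n)"
    using Suc.hyps by (simp add: ln_div)
  with Suc.IH show ?case by simp
qed simp

text \<open>For nonzero x and y the bound on the product implies the other two; these cut off the
  axes, where the product says nothing.\<close>

definition hyperbolic_pairs :: "real \<Rightarrow> (int \<times> int) set" where
  "hyperbolic_pairs Y = {(x, y). \<bar>of_int x\<bar> \<le> Y \<and> \<bar>of_int y\<bar> \<le> Y \<and> \<bar>of_int (x * y)\<bar> \<le> Y}"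

lemma finite_hyperbolic_pairs: "finite (hyperbolic_pairs Y)"
  by (rule finite_subset[of _ "{- \<lfloor>Y\<rfloor>..\<lfloor>Y\<rfloor>} \<times> {- \<lfloor>Y\<rfloor>..\<lfloor>Y\<rfloor>}"])
    (auto simp: hyperbolic_pairs_def; linarith)+

lemma card_int_abs_le:
  assumes "t \<ge> 0"
  shows "finite {y::int. \<bar>of_int y\<bar> \<le> t}" "real (card {y::int. \<bar>of_int y\<bar> \<le> t}) \<le> 2 * t + 1"
proof -
  have "{y::int. \<bar>of_int y\<bar> \<le> t} = {- \<lfloor>t\<rfloor>..\<lfloor>t\<rfloor>}" by (auto; linarith)
  then show "finite {y::int. \<bar>of_int y\<bar> \<le> t}" "real (card {y::int. \<bar>of_int y\<bar> \<le> t}) \<le> 2 * t + 1"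
    using assms by auto
qed

lemma card_hyperbolic_pairs_le:
  assumes "Y \<ge> 1"
  shows "real (card (hyperbolic_pairs Y)) \<le> 9 * (Y * (1 + ln Y))"
proof -
  define n where "n = nat \<lfloor>Y\<rfloor>"
  have n: "n \<ge> 1" "real n \<le> Y" using assms by (auto simp: n_def le_nat_floor)
  \<comment> \<open>For \<open>k = 0\<close> the product does not restrict y and only the box does.
    For the other \<open>k\<close> the sizes 2Y/k + 1 add up to a harmonic sum.\<close>
  define B where "B k = {y::int. \<bar>of_int y\<bar> \<le> (if k = 0 then Y else Y / real k)}" for k
  have B: "finite (B k)" "real (card (B k)) \<le> (if k = 0 then 2 * Y + 1 else 2 * Y * (1 / real k) + 1)" for k
    using card_int_abs_le[of "if k = 0 then Y else Y / real k"] assms by (auto simp: B_def)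
  define A where "A = {0::int} \<times> B 0 \<union> (\<Union>k\<in>{1..n}. {int k, - int k} \<times> B k)"
  have "hyperbolic_pairs Y \<subseteq> A"
  proof
    fix z assume "z \<in> hyperbolic_pairs Y"
    then obtain x y where z: "z = (x, y)" and h: "\<bar>of_int x\<bar> \<le> Y" "\<bar>of_int y\<bar> \<le> Y" "\<bar>of_int (x * y)\<bar> \<le> Y"
      by (auto simp: hyperbolic_pairs_def)
    show "z \<in> A"
    proof (cases "x = 0")
      case True
      then show ?thesis using h by (auto simp: A_def B_def z)
    next
      case False
      define k where "k = nat \<bar>x\<bar>"
      have k: "k \<ge> 1" "k \<le> n" "x = int k \<or> x = - int k"
        using False h(1) by (auto simp: k_def n_def) linarith
      have rk: "real k = \<bar>of_int x\<bar>" by (simp add: k_def)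
      have "\<bar>of_int y\<bar> \<le> Y / real k"
        using h(3) False unfolding rk by (simp add: abs_mult field_simps)
      then have "y \<in> B k" using k(1) by (simp add: B_def)
      then show ?thesis using k by (auto simp: A_def z)
    qed
  qed
  then have "card (hyperbolic_pairs Y) \<le> card A"
    by (intro card_mono) (auto simp: A_def B)
  also have "card A \<le> card (B 0) + (\<Sum>k\<in>{1..n}. card ({int k, - int k} \<times> B k))"
    unfolding A_def
    by (rule order_trans[OF card_Un_le]) (intro add_mono card_UN_le, auto simp: card_cartesian_product)
  also have "\<dots> \<le> card (B 0) + (\<Sum>k\<in>{1..n}. 2 * card (B k))"
    by (intro add_left_mono sum_mono) (auto simp: card_cartesian_product card_insert_if)
  finally have "real (card (hyperbolic_pairs Y)) \<le> real (card (B 0)) + (\<Sum>k=1..n. 2 * real (card (B k)))"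
    by (metis (mono_tags, lifting) of_nat_add of_nat_le_iff of_nat_mult of_nat_numeral of_nat_sum sum.cong)
  also have "\<dots> \<le> (2 * Y + 1) + (\<Sum>k=1..n. 2 * (2 * Y * (1 / real k) + 1))"
    by (intro add_mono sum_mono mult_left_mono order_trans[OF B(2)]) auto
  also have "(\<Sum>k=1..n. 2 * (2 * Y * (1 / real k) + 1)) = 4 * Y * (\<Sum>k=1..n. 1 / real k) + 2 * real n"
    by (simp add: sum.distrib sum_distrib_left algebra_simps)
  also have "\<dots> \<le> 4 * Y * (1 + ln (real n)) + 2 * real n"
    using sum_inverse_le_ln[OF n(1)] assms by (intro add_mono mult_left_mono) auto
  also have "\<dots> \<le> 4 * Y * (1 + ln Y) + 2 * Y"
    using n assms by (intro add_mono mult_left_mono) auto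
  finally have "real (card (hyperbolic_pairs Y)) \<le> 4 * Y * (1 + ln Y) + 4 * Y + 1" by simp
  moreover have "Y \<le> Y * (1 + ln Y)" using assms by (simp add: algebra_simps)
  ultimately show ?thesis using assms by linarith
qed

section \<open>Counting unimodular substitutions\<close>

text \<open>The value at w of the i-th linear form p_i X + r_i Y. Read as functions of the index,
  \<open>lin p r u\<close> and \<open>lin p r v\<close> are the coefficients of the forms after the
  substitution with columns u and v.\<close>

definition lin :: "(nat \<Rightarrow> complex) \<Rightarrow> (nat \<Rightarrow> complex) \<Rightarrow> int \<times> int \<Rightarrow> nat \<Rightarrow> complex" where
  "lin p r w i = p i * of_int (fst w) + r i * of_int (snd w)"

definition balanced :: "(nat \<Rightarrow> complex) \<Rightarrow> (nat \<Rightarrow> complex) \<Rightarrow> real \<Rightarrow> bool" where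
  "balanced p r \<kappa> \<longleftrightarrow> (\<forall>i<3. \<forall>j<3. i \<noteq> j \<longrightarrow> cmod (p i * r j - p j * r i) = \<kappa>)"

definition SL2 :: "((int \<times> int) \<times> (int \<times> int)) set" where
  "SL2 = {(u, v). det2 u v = 1}"

lemma det2_primitive:
  assumes "\<bar>det2 u v\<bar> = 1"
  shows "primitive v"
proof (rule coprimeI)
  fix c assume "c dvd fst v" "c dvd snd v"
  then have "c dvd det2 u v" by (simp add: det2_def)
  then show "is_unit c" using assms by (metis dvd_abs_iff)
qed

text \<open>Multiplicativity of 2x2 determinants. It converts bounds on the values of two forms at
  two vectors into a bound on the determinant of the vectors.\<close>

lemma lin_det2:
  "lin p r u i * lin p r v j - lin p r v i * lin p r u j = (p i * r j - p j * r i) * of_int (det2 u v)"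
  by (simp add: lin_def det2_def algebra_simps)

text \<open>The second columns are primitive with pairwise determinants at most 2AB/\<kappa>, so
  there are at most 2 + 18AB/\<kappa> of them. Any member of \<open>G\<close> gives \<kappa> <= 2AB,
  which turns this into 22AB/\<kappa>. For fixed v two first columns differ by a multiple m v, and
  |L_i(u)| <= |L_i(v)| forces |m| <= 2; hence 5 * 22 = 110.\<close>

lemma card_unimodular_pairs_le:
  fixes G :: "((int \<times> int) \<times> (int \<times> int)) set"
  assumes e: "e = 1 \<or> e = - 1" and \<kappa>: "\<kappa> > 0" "cmod (p i * r k - p k * r i) = \<kappa>"
    and AB: "A \<ge> 0" "B \<ge> 0"
    and G: "\<And>u v. (u, v) \<in> G \<Longrightarrow> det2 u v = e \<and> cmod (lin p r u i) \<le> cmod (lin p r v i)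
        \<and> cmod (lin p r v i) \<le> A \<and> cmod (lin p r u k) \<le> B \<and> cmod (lin p r v k) \<le> B"
  shows "finite G \<and> real (card G) \<le> 110 * (A * B) / \<kappa>"
proof (cases "G = {}")
  case True
  then show ?thesis using \<kappa> AB by simp
next
  case False
  define S where "S = snd ` G"
  define \<Delta> where "\<Delta> = \<lfloor>2 * (A * B) / \<kappa>\<rfloor>"
  have det_bd: "\<kappa> * \<bar>real_of_int (det2 w z)\<bar> \<le> 2 * (A * B)"
    if "cmod (lin p r w i) \<le> A" "cmod (lin p r w k) \<le> B" "cmod (lin p r z i) \<le> A" "cmod (lin p r z k) \<le> B" for w z
  proof -
    have "\<kappa> * \<bar>real_of_int (det2 w z)\<bar> = cmod (lin p r w i * lin p r z k - lin p r z i * lin p r w k)"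
      unfolding lin_det2 norm_mult \<kappa>(2) by simp
    also have "\<dots> \<le> cmod (lin p r w i) * cmod (lin p r z k) + cmod (lin p r z i) * cmod (lin p r w k)"
      by (metis norm_mult norm_triangle_ineq4)
    also have "\<dots> \<le> A * B + A * B" using that AB by (intro add_mono mult_mono) auto
    finally show ?thesis by simp
  qed
  have det_S: "\<bar>det2 w z\<bar> \<le> \<Delta>" if "w \<in> S" "z \<in> S" for w z
  proof -
    have "\<kappa> * \<bar>real_of_int (det2 w z)\<bar> \<le> 2 * (A * B)"
      using that G by (intro det_bd) (auto simp: S_def)
    then show ?thesis using \<kappa> by (simp add: \<Delta>_def le_floor_iff field_simps)
  qed
  obtain u v where uv: "(u, v) \<in> G" using False by auto
  have "\<kappa> * \<bar>real_of_int (det2 u v)\<bar> \<le> 2 * (A * B)"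
    using G[OF uv] by (intro det_bd) auto
  then have AB_ge: "\<kappa> \<le> 2 * (A * B)" using G[OF uv] e by auto
  have \<Delta>0: "\<Delta> \<ge> 0" using AB \<kappa> by (simp add: \<Delta>_def)
  have prim: "primitive w" if w: "w \<in> S" for w
  proof -
    obtain u where "(u, w) \<in> G" using w by (auto simp: S_def)
    then show ?thesis using G e det2_primitive by (metis abs_1 abs_minus_cancel)
  qed
  have S: "finite S" "int (card S) \<le> 2 + 9 * \<Delta>"
    using card_primitive_le[of S \<Delta>] prim \<Delta>0 det_S by auto
  have "real (card S) = real_of_int (int (card S))" by simp
  also have "\<dots> \<le> real_of_int (2 + 9 * \<Delta>)" using S(2) by (intro of_int_le_iff[THEN iffD2])
  also have "\<dots> \<le> 2 + 9 * (2 * (A * B) / \<kappa>)"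
    unfolding \<Delta>_def of_int_add of_int_mult of_int_numeral
    by (intro add_left_mono mult_left_mono of_int_floor_le) simp
  also have "\<dots> \<le> 22 * (A * B) / \<kappa>" using AB_ge \<kappa>(1) by (simp add: field_simps)
  finally have cS: "real (card S) \<le> 22 * (A * B) / \<kappa>" .
  define u0 where "u0 v = (SOME u. (u, v) \<in> G)" for v
  define h where "h = (\<lambda>(v, m). ((fst (u0 v) + m * fst v, snd (u0 v) + m * snd v), v :: int \<times> int))"
  have "G \<subseteq> h ` (S \<times> {- 2..2})"
  proof
    fix g assume g: "g \<in> G"
    obtain u v where uv: "g = (u, v)" by (cases g)
    have u0: "(u0 v, v) \<in> G" unfolding u0_def using g uv by (metis someI)
    have "det2 (fst u - fst (u0 v), snd u - snd (u0 v)) v = 0"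
      using G[of u v] G[OF u0] g by (simp add: uv det2_def algebra_simps)
    then obtain m where m: "(fst u - fst (u0 v), snd u - snd (u0 v)) = (m * fst v, m * snd v)"
      using det2_eq_0_imp_multiple prim[of v] g by (metis S_def imageI snd_conv uv)
    have lu: "lin p r u i - lin p r (u0 v) i = of_int m * lin p r v i"
    proof -
      have "of_int (fst u) - of_int (fst (u0 v)) = (of_int m * of_int (fst v) :: complex)"
        "of_int (snd u) - of_int (snd (u0 v)) = (of_int m * of_int (snd v) :: complex)"
        using m by (metis fst_conv snd_conv of_int_diff of_int_mult)+
      then show ?thesis by (simp add: lin_def algebra_simps)
    qed
    have "\<bar>of_int m\<bar> * cmod (lin p r v i) = cmod (lin p r u i - lin p r (u0 v) i)"
      unfolding lu by (simp add: norm_mult)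
    also have "\<dots> \<le> cmod (lin p r v i) + cmod (lin p r v i)"
      using G[of u v] G[OF u0] g uv by (intro order_trans[OF norm_triangle_ineq4] add_mono) auto
    finally have m2: "\<bar>of_int m\<bar> * cmod (lin p r v i) \<le> 2 * cmod (lin p r v i)" by simp
    have "lin p r v i \<noteq> 0"
    proof
      assume 0: "lin p r v i = 0"
      then have "lin p r u i = 0" using G[of u v] g uv by auto
      then have "(p i * r k - p k * r i) * of_int (det2 u v) = 0"
        using 0 by (simp flip: lin_det2)
      then show False using G[of u v] g uv e \<kappa> by auto
    qed
    then have "\<bar>of_int m\<bar> \<le> (2::real)" using m2 by simp
    then have "m \<in> {- 2..2}" by auto
    moreover have "v \<in> S" using g uv by (force simp: S_def)
    moreover have "g = h (v, m)" using m by (auto simp: uv h_def prod_eq_iff)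
    ultimately show "g \<in> h ` (S \<times> {- 2..2})" by blast
  qed
  then have fin: "finite G" and "card G \<le> card (h ` (S \<times> {- 2..2}))"
    using S(1) by (auto intro: finite_subset card_mono)
  note this(2)
  also have "card (h ` (S \<times> {- 2..2})) \<le> card (S \<times> {- 2..2::int})" using S(1) by (intro card_image_le) auto
  also have "\<dots> = card S * 5" by (simp add: card_cartesian_product)
  finally have "real (card G) \<le> 5 * real (card S)" by linarith
  also have "\<dots> \<le> 5 * (22 * (A * B) / \<kappa>)" using cS by simp
  finally show ?thesis using fin by simp
qed

text \<open>A linear form can be small at no more than one of the points \<open>(1,0)\<close>, \<open>(0,1)\<close>, \<open>(1,1)\<close>,
  \<open>(1,-1)\<close>, so three forms are simultaneously large at one of these four points.\<close>
lemma prod_max_le: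
  fixes P R :: "nat \<Rightarrow> complex"
  assumes "cmod (P 0 * P 1 * P 2) \<le> H" "cmod (R 0 * R 1 * R 2) \<le> H"
    and "cmod ((P 0 + R 0) * (P 1 + R 1) * (P 2 + R 2)) \<le> H"
    and "cmod ((P 0 - R 0) * (P 1 - R 1) * (P 2 - R 2)) \<le> H"
  defines "M \<equiv> \<lambda>i. max (cmod (P i)) (cmod (R i))"
  shows "M 0 * M 1 * M 2 \<le> 27 * H"
proof -
  have tri: "cmod a \<le> cmod (a + b) + cmod b" "cmod b \<le> cmod (a + b) + cmod a"
    "cmod a \<le> cmod (a - b) + cmod b" "cmod b \<le> cmod (a - b) + cmod a"
    "2 * cmod a \<le> cmod (a + b) + cmod (a - b)" "2 * cmod b \<le> cmod (a + b) + cmod (a - b)" for a b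
  proof -
    show "cmod a \<le> cmod (a + b) + cmod b" "cmod b \<le> cmod (a + b) + cmod a"
      "cmod a \<le> cmod (a - b) + cmod b" "cmod b \<le> cmod (a - b) + cmod a"
      using norm_triangle_ineq4[of "a + b" b] norm_triangle_ineq4[of "a + b" a]
        norm_triangle_ineq[of "a - b" b] norm_triangle_ineq4[of "a" "a - b"] by auto
    show "2 * cmod a \<le> cmod (a + b) + cmod (a - b)" "2 * cmod b \<le> cmod (a + b) + cmod (a - b)"
      using norm_triangle_ineq[of "a + b" "a - b"] norm_triangle_ineq4[of "a + b" "a - b"]
      by (auto simp: norm_mult simp flip: mult_2)
  qed
  define T where "T j i = (if j = 0 then P i else if j = 1 then R i else if j = 2 then P i + R i else P i - R i)" for j i :: nat
  have one: "cmod (T j i) \<ge> M i / 3 \<or> cmod (T j' i) \<ge> M i / 3" if "j < j'" "j' < 4" for i j j'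
  proof -
    have "j \<in> {0,1,2}" "j' \<in> {1,2,3}" using that by auto
    then show ?thesis using that tri[where a = "P i" and b = "R i"] by (auto simp: T_def M_def max_def split: if_splits)
  qed
  have "\<exists>j<4. \<forall>i<3. cmod (T j i) \<ge> M i / 3"
  proof (rule ccontr)
    assume "\<not> ?thesis"
    \<comment> \<open>\<open>f j\<close> is a form that is small at the j-th point. By
      \<open>one\<close> no form is small at two points, so \<open>f\<close> would embed four points
      into three forms.\<close>
    then obtain f where f: "\<And>j. j < 4 \<Longrightarrow> f j < 3 \<and> \<not> cmod (T j (f j)) \<ge> M (f j) / 3" by metis
    have "inj_on f {..<4}"
    proof (rule inj_onI)
      fix j j' assume "j \<in> {..<4}" "j' \<in> {..<4}" "f j = f j'"
      then show "j = j'" using f one by (metis lessThan_iff nat_neq_iff)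
    qed
    moreover have "f ` {..<4} \<subseteq> {..<3}" using f by auto
    ultimately have "card {..<4::nat} \<le> card {..<3::nat}" by (intro card_inj_on_le) auto
    then show False by simp
  qed
  then obtain j where j: "j < 4" "\<And>i. i < 3 \<Longrightarrow> cmod (T j i) \<ge> M i / 3" by auto
  have M0: "M i \<ge> 0" for i by (simp add: M_def le_max_iff_disj)
  have "M 0 / 3 * (M 1 / 3) * (M 2 / 3) \<le> cmod (T j 0) * cmod (T j 1) * cmod (T j 2)"
    using j(2) M0 by (intro mult_mono) auto
  also have "\<dots> = cmod (T j 0 * T j 1 * T j 2)" by (simp add: norm_mult)
  also have "\<dots> \<le> H" using assms(1-4) by (auto simp: T_def)
  finally show ?thesis by simp
qed

text \<open>The forms satisfy a linear relation whose coefficients are their pairwise determinants,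
  which all have absolute value \<open>\<kappa>\<close>.\<close>

lemma balanced_triangle:
  assumes b: "balanced p r \<kappa>" and \<kappa>: "\<kappa> > 0" and ijk: "{i, j, k} = {0, 1, 2}"
  shows "cmod (lin p r w i) \<le> cmod (lin p r w j) + cmod (lin p r w k)"
proof -
  have d: "i < 3" "j < 3" "k < 3" "i \<noteq> j" "i \<noteq> k" "j \<noteq> k"
  proof -
    have "i \<in> {0,1,2}" "j \<in> {0,1,2}" "k \<in> {0,1,2}" using ijk by blast+
    then show "i < 3" "j < 3" "k < 3" by auto
    have "card {i, j, k} = 3" using ijk by simp
    then show "i \<noteq> j" "i \<noteq> k" "j \<noteq> k" by (auto simp: card_insert_if split: if_splits)
  qed
  have "(p j * r k - p k * r j) * lin p r w i =
    (p i * r k - p k * r i) * lin p r w j - (p i * r j - p j * r i) * lin p r w k"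
    by (simp add: lin_def algebra_simps)
  then have "cmod ((p j * r k - p k * r j) * lin p r w i) \<le>
    cmod ((p i * r k - p k * r i) * lin p r w j) + cmod ((p i * r j - p j * r i) * lin p r w k)"
    by (simp add: norm_triangle_ineq4)
  then have "\<kappa> * cmod (lin p r w i) \<le> \<kappa> * cmod (lin p r w j) + \<kappa> * cmod (lin p r w k)"
    using b d unfolding norm_mult balanced_def by metis
  then show ?thesis using \<kappa> by (simp flip: distrib_left)
qed

definition linmax :: "(nat \<Rightarrow> complex) \<Rightarrow> (nat \<Rightarrow> complex) \<Rightarrow> int \<times> int \<Rightarrow> int \<times> int \<Rightarrow> nat \<Rightarrow> real" where
  "linmax p r u v i = max (cmod (lin p r u i)) (cmod (lin p r v i))"

lemma powr_two_thirds_cubed: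
  fixes x :: real
  assumes "x > 0"
  shows "(x powr (2/3)) ^ 3 = x\<^sup>2"
proof -
  have "(x powr (2/3)) ^ 3 = (x powr (2/3)) powr real 3"
    by (rule powr_realpow [symmetric]) (use assms in simp)
  also have "\<dots> = x powr real 2" unfolding powr_powr by simp
  also have "\<dots> = x\<^sup>2" by (rule powr_realpow) fact
  finally show ?thesis .
qed

text \<open>The scale is measured on twice the maximum: later only M_i >= 1/2 is known, and this
  keeps the exponent \<open>n\<close> a natural number.\<close>

lemma card_dyadic_unimodular_le:
  fixes n :: nat
  assumes b: "balanced p r \<kappa>" and \<kappa>: "\<kappa> > 0" and ik: "i < 3" "k < 3" "i \<noteq> k" and K: "K > 0" and e: "e = 1 \<or> e = -1"
  defines "G \<equiv> {(u, v). det2 u v = e \<and> cmod (lin p r u i) \<le> cmod (lin p r v i)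
       \<and> linmax p r u v k \<le> linmax p r u v i \<and> (linmax p r u v i)\<^sup>2 * linmax p r u v k \<le> 2 * K
       \<and> 2 ^ n \<le> 2 * linmax p r u v i \<and> 2 * linmax p r u v i \<le> 2 ^ Suc n}"
  shows "finite G \<and> real (card G) \<le> 440 * K powr (2/3) / \<kappa>"
proof -
  define A :: real where "A = 2 ^ n"
  \<comment> \<open>The second bound is 2K / (A/2)^2, coming from M_i >= A/2 and M_i^2 M_k <=
    2K.\<close>
  define B where "B = min A (8 * K / A\<^sup>2)"
  have pos: "A > 0" "B > 0" using K by (auto simp: A_def B_def)
  have *: "finite G \<and> real (card G) \<le> 110 * (A * B) / \<kappa>"
  proof (rule card_unimodular_pairs_le[OF e \<kappa>])
    show "cmod (p i * r k - p k * r i) = \<kappa>" using b ik by (simp add: balanced_def)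
    fix u v assume "(u, v) \<in> G"
    then have h: "det2 u v = e" "cmod (lin p r u i) \<le> cmod (lin p r v i)"
      "linmax p r u v k \<le> linmax p r u v i" "(linmax p r u v i)\<^sup>2 * linmax p r u v k \<le> 2 * K"
      "A \<le> 2 * linmax p r u v i" "linmax p r u v i \<le> A"
      by (auto simp: G_def A_def)
    have k0: "0 \<le> linmax p r u v k" by (simp add: linmax_def le_max_iff_disj)
    have "(A / 2)\<^sup>2 * linmax p r u v k \<le> (linmax p r u v i)\<^sup>2 * linmax p r u v k"
      using h(5) pos k0 by (intro mult_right_mono power_mono) auto
    then have "linmax p r u v k \<le> 8 * K / A\<^sup>2"
      using h(4) pos by (simp add: field_simps power2_eq_square)
    then have kB: "linmax p r u v k \<le> B" using h by (simp add: B_def)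
    show "det2 u v = e \<and> cmod (lin p r u i) \<le> cmod (lin p r v i)
        \<and> cmod (lin p r v i) \<le> A \<and> cmod (lin p r u k) \<le> B \<and> cmod (lin p r v k) \<le> B"
      using h kB by (auto simp: linmax_def)
  qed (use pos in auto)
  have "(A * B) ^ 3 = A ^ 3 * (B * (B * B))" by (simp add: power_mult_distrib power3_eq_cube)
  \<comment> \<open>One factor \<open>B\<close> is bounded by \<open>A\<close> and the other two by
    \<open>8 * K / A^2\<close>. Then all powers of \<open>A\<close> cancel, so the bound is the same
    at every scale.\<close>
  also have "\<dots> \<le> A ^ 3 * (A * (8 * K / A\<^sup>2 * (8 * K / A\<^sup>2)))"
    using pos K by (intro mult_left_mono mult_mono) (auto simp: B_def)
  also have "\<dots> = 64 * K\<^sup>2" using pos by (simp add: field_simps power2_eq_square power3_eq_cube)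
  also have "\<dots> = (4 * K powr (2/3)) ^ 3"
    using K by (simp add: power_mult_distrib powr_two_thirds_cubed)
  finally have "A * B \<le> 4 * K powr (2/3)" by (rule power_le_imp_le_base[where n = 2, simplified]) simp
  then have "110 * (A * B) / \<kappa> \<le> 440 * K powr (2/3) / \<kappa>" using \<kappa> by (simp add: divide_right_mono)
  with * show ?thesis by linarith
qed

lemma dyadic_bracket:
  fixes x :: real
  assumes "x \<ge> 1"
  obtains n :: nat where "2 ^ n \<le> x" "x \<le> 2 ^ Suc n"
proof
  define n where "n = nat \<lfloor>log 2 x\<rfloor>"
  have l0: "log 2 x \<ge> 0" using assms by simp
  have n: "real n \<le> log 2 x" "log 2 x \<le> real (Suc n)" using l0 by (auto simp: n_def) linarith
  have "2 ^ n = 2 powr real n" by (simp add: powr_realpow)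
  also have "\<dots> \<le> 2 powr log 2 x" using n by (intro powr_mono) auto
  finally show "2 ^ n \<le> x" using assms by simp
  have "x = 2 powr log 2 x" using assms by simp
  also have "\<dots> \<le> 2 powr real (Suc n)" using n by (intro powr_mono) auto
  finally show "x \<le> 2 ^ Suc n" by (simp add: powr_realpow del: of_nat_Suc)
qed

lemma card_powers_of_two_le:
  fixes H :: real
  assumes "H \<ge> 1"
  shows "finite {n::nat. 2 ^ n \<le> 2 ^ 10 * H} \<and> real (card {n::nat. 2 ^ n \<le> 2 ^ 10 * H}) \<le> 11 * (1 + ln H)"
proof -
  have le: "real n \<le> 10 + 2 * ln H" if "2 ^ n \<le> 2 ^ 10 * H" for n
  proof -
    have "ln (2 ^ n) \<le> ln (2 ^ 10 * H)" using that assms by (subst ln_le_cancel_iff) auto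
    then have "real n * ln 2 \<le> 10 * ln 2 + ln H" using assms by (simp add: ln_mult ln_realpow del: power_numeral)
    moreover have "ln (2::real) \<ge> 1/2" using ln_le_minus_one[of "1/2::real"] by (simp add: ln_div)
    moreover from this have "ln H \<le> 2 * ln H * ln 2"
      using mult_left_mono[of "1/2" "ln 2" "2 * ln H"] assms by simp
    ultimately have "real n * ln 2 \<le> (10 + 2 * ln H) * ln 2" by (simp add: algebra_simps)
    then show ?thesis by simp
  qed
  then have sub: "{n::nat. 2 ^ n \<le> 2 ^ 10 * H} \<subseteq> {.. nat \<lfloor>10 + 2 * ln H\<rfloor>}"
    by (intro subsetI, simp only: mem_Collect_eq atMost_iff) (rule le_nat_floor)
  then have "card {n::nat. 2 ^ n \<le> 2 ^ 10 * H} \<le> Suc (nat \<lfloor>10 + 2 * ln H\<rfloor>)"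
    using card_mono[OF _ sub] by simp
  moreover have "real (nat \<lfloor>10 + 2 * ln H\<rfloor>) \<le> 10 + 2 * ln H" using assms by (simp add: of_nat_floor)
  moreover have "ln H \<ge> 0" using assms by simp
  ultimately have "real (card {n::nat. 2 ^ n \<le> 2 ^ 10 * H}) \<le> 11 * (1 + ln H)"
    by (simp only: distrib_left)
  then show ?thesis using finite_subset[OF sub] by simp
qed

text \<open>Let M_k be the smallest maximum. The triangle inequality gives M_i <= M_j + M_k <= 2
  M_j, hence M_i^2 M_k <= 2K, as the dyadic count requires. Unimodularity gives \<kappa> <= 2 M_i
  M_k; with \<kappa> >= 1 this bounds M_i below by 1/2 and above by a multiple of H, leaving O(1 +
  log H) scales.\<close>

lemma card_SL2_le:
  assumes b: "balanced p r \<kappa>" and \<kappa>: "\<kappa> \<ge> 1" and H: "H \<ge> 1"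
  defines "G \<equiv> {(u, v). (u, v) \<in> SL2 \<and> linmax p r u v 0 * linmax p r u v 1 * linmax p r u v 2 \<le> 108 * H}"
  shows "finite G \<and> real (card G) \<le> 667920 * (H powr (2/3) * (1 + ln H) / \<kappa>)"
proof -
  define K where "K = 108 * H"
  have K: "K > 0" using H by (simp add: K_def)
  \<comment> \<open>A scale that occurs satisfies 2^n <= 8K = 864 H, and 864 <= 2^10.\<close>
  define L where "L = {n::nat. 2 ^ n \<le> 2 ^ 10 * H}"
  \<comment> \<open>Some index other than \<open>k\<close>; either of the two larger forms may set
    the scale.\<close>
  define I where "I k = (if k = 0 then 1 else 0 :: nat)" for k :: nat
  define Q where "Q e k n = {(u, v). det2 u v = e \<and> cmod (lin p r u (I k)) \<le> cmod (lin p r v (I k))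
       \<and> linmax p r u v k \<le> linmax p r u v (I k) \<and> (linmax p r u v (I k))\<^sup>2 * linmax p r u v k \<le> 2 * K
       \<and> 2 ^ n \<le> 2 * linmax p r u v (I k) \<and> 2 * linmax p r u v (I k) \<le> 2 ^ Suc n}" for e k n
  \<comment> \<open>The dyadic count wants the form \<open>I k\<close> to be larger at the second
    column. Swapping the columns arranges this and changes the determinant to -1.\<close>
  define X where "X = (\<Union>k\<in>{..<3}. \<Union>n\<in>L. Q 1 k n \<union> prod.swap ` Q (-1) k n)"
  have Q: "finite (Q e k n)" "real (card (Q e k n)) \<le> 440 * K powr (2/3) / \<kappa>"
    if "k < 3" "e = 1 \<or> e = -1" for e k n
    using card_dyadic_unimodular_le[OF b _ _ that(1) _ K that(2), of "I k" n] \<kappa>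
    by (auto simp: Q_def I_def)
  have L: "finite L" "real (card L) \<le> 11 * (1 + ln H)"
    using card_powers_of_two_le[OF H] by (auto simp: L_def)
  have "G \<subseteq> X"
  proof
    fix g assume g: "g \<in> G"
    obtain u v where uv: "g = (u, v)" by (cases g)
    define M where "M = linmax p r u v"
    have M0: "M i \<ge> 0" for i by (simp add: M_def linmax_def le_max_iff_disj)
    have det: "det2 u v = 1" and prod: "M 0 * M 1 * M 2 \<le> K"
      using g by (auto simp: uv G_def SL2_def K_def M_def)
    have tri: "M i \<le> M j + M k" if "{i, j, k} = {0, 1, 2}" for i j k
      using balanced_triangle[OF b _ that, of u] balanced_triangle[OF b _ that, of v] \<kappa>
      by (simp add: M_def linmax_def max_def)
    have \<kappa>M: "\<kappa> \<le> 2 * (M i * M j)" if "i < 3" "j < 3" "i \<noteq> j" for i j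
    proof -
      have "\<kappa> = cmod (lin p r u i * lin p r v j - lin p r v i * lin p r u j)"
        using b that unfolding lin_det2 det balanced_def by simp
      also have "\<dots> \<le> cmod (lin p r u i) * cmod (lin p r v j) + cmod (lin p r v i) * cmod (lin p r u j)"
        by (metis norm_mult norm_triangle_ineq4)
      also have "\<dots> \<le> M i * M j + M i * M j"
        by (intro add_mono mult_mono) (auto simp: M_def linmax_def le_max_iff_disj)
      finally show ?thesis by simp
    qed
    have "\<exists>k<3. \<forall>i<3. M k \<le> M i"
    proof -
      have "Min (M ` {..<3}) \<in> M ` {..<3}" by (intro Min_in) (auto simp: lessThan_empty_iff)
      then obtain k where k: "k < 3" "M k = Min (M ` {..<3})" by auto
      have "M k \<le> M i" if "i < 3" for i unfolding k(2) using that by (intro Min_le) auto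
      with k show ?thesis by blast
    qed
    then obtain k where k: "k < 3" "\<And>i. i < 3 \<Longrightarrow> M k \<le> M i" by blast
    define i where "i = I k"
    define j where "j = (if k = 2 then 1 else 2 :: nat)"
    have ij: "i < 3" "j < 3" "i \<noteq> k" "{i, j, k} = {0, 1, 2}"
      using k(1) by (auto simp: i_def I_def j_def)
    have "M i * M j * M k = M 0 * M 1 * M 2"
      using k(1) by (auto simp: i_def I_def j_def less_Suc_eq numeral_3_eq_3)
    then have prod': "M i * M j * M k \<le> K" using prod by simp
    have "M i \<le> 2 * M j" using tri[OF ij(4)] k(2)[OF ij(2)] by simp
    then have "M i * M i * M k \<le> M i * (2 * M j) * M k"
      using M0 by (intro mult_right_mono mult_left_mono) auto
    also have "\<dots> = 2 * (M i * M j * M k)" by simp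
    also have "\<dots> \<le> 2 * K" using prod' by simp
    finally have sq: "(M i)\<^sup>2 * M k \<le> 2 * K" by (simp only: power2_eq_square)
    have ki: "M k \<le> M i" using k ij by simp
    have \<kappa>ik: "\<kappa> \<le> 2 * (M i * M k)" using \<kappa>M ij k by simp
    also have "\<dots> \<le> 2 * (M i * M i)" using ki M0 by (simp add: mult_left_mono)
    finally have "1 \<le> 2 * (M i * M i)" using \<kappa> by simp
    then have "1 \<le> 2 * M i"
      using M0[of i] mult_mono[of "M i" "1/2" "M i" "1/2"] by (cases "M i \<le> 1/2") auto
    then obtain n where n: "2 ^ n \<le> 2 * M i" "2 * M i \<le> 2 ^ Suc n" by (rule dyadic_bracket)
    have "2 ^ n \<le> 2 * M i * 1" using n by simp
    also have "\<dots> \<le> 2 * M i * (2 * (M i * M k))" using M0 \<kappa>ik \<kappa> by (intro mult_left_mono) auto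
    also have "\<dots> = 4 * ((M i)\<^sup>2 * M k)" by (simp add: power2_eq_square)
    also have "\<dots> \<le> 4 * (2 * K)" by (rule mult_left_mono[OF sq]) simp
    also have "\<dots> \<le> 2 ^ 10 * H" using H by (simp add: K_def)
    finally have nL: "n \<in> L" by (simp add: L_def)
    show "g \<in> X"
    proof (cases "cmod (lin p r u i) \<le> cmod (lin p r v i)")
      case True
      then have "g \<in> Q 1 k n"
        using det ki sq n by (auto simp: uv Q_def M_def i_def)
      then show ?thesis using k nL by (auto simp: X_def)
    next
      case False
      have sw: "linmax p r v u = M" by (auto simp: M_def linmax_def max.commute)
      have "(v, u) \<in> Q (-1) k n"
        using det det2_commute[of v u] ki sq n False by (simp add: uv Q_def sw flip: i_def)
      then have "g \<in> prod.swap ` Q (-1) k n" by (force simp: uv)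
      then show ?thesis using k nL by (auto simp: X_def)
    qed
  qed
  moreover have "finite X" using L Q by (auto simp: X_def)
  ultimately have fin: "finite G" and "card G \<le> card X" by (auto intro: finite_subset card_mono)
  have "card X \<le> (\<Sum>k\<in>{..<3}. \<Sum>n\<in>L. card (Q 1 k n) + card (Q (-1) k n))"
    unfolding X_def using L Q
    by (intro order_trans[OF card_UN_le] sum_mono order_trans[OF card_Un_le] add_mono card_image_le) auto
  with \<open>card G \<le> card X\<close> have "card G \<le> (\<Sum>k\<in>{..<3}. \<Sum>n\<in>L. card (Q 1 k n) + card (Q (-1) k n))" by simp
  then have "real (card G) \<le> (\<Sum>k\<in>{..<3::nat}. \<Sum>n\<in>L. real (card (Q 1 k n)) + real (card (Q (-1) k n)))"
    by (simp flip: of_nat_add of_nat_sum)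
  also have "\<dots> \<le> (\<Sum>k\<in>{..<3::nat}. \<Sum>n\<in>L. 440 * K powr (2/3) / \<kappa> + 440 * K powr (2/3) / \<kappa>)"
    using Q by (intro sum_mono add_mono) auto
  also have "\<dots> = 2640 * K powr (2/3) / \<kappa> * real (card L)" by simp
  also have "\<dots> \<le> 2640 * K powr (2/3) / \<kappa> * (11 * (1 + ln H))"
    using L(2) \<kappa> by (intro mult_left_mono) auto
  also have "\<dots> \<le> 2640 * (23 * H powr (2/3)) / \<kappa> * (11 * (1 + ln H))"
  proof -
    \<comment> \<open>108^2 = 11664 <= 12167 = 23^3.\<close>
    have "(108 powr (2/3)) ^ 3 \<le> (23 :: real) ^ 3"
      by (simp add: powr_two_thirds_cubed)
    then have "108 powr (2/3) \<le> (23 :: real)" by (rule power_le_imp_le_base[where n = 2, simplified]) simp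
    then have "K powr (2/3) \<le> 23 * H powr (2/3)" using H by (simp add: K_def powr_mult mult_right_mono)
    then show ?thesis using \<kappa> H by (intro mult_right_mono divide_right_mono mult_left_mono) auto
  qed
  also have "\<dots> = 667920 * (H powr (2/3) * (1 + ln H) / \<kappa>)" by simp
  finally show ?thesis using fin by simp
qed

section \<open>Factorised binary cubic forms\<close>

text \<open>A quadruple (a, b, c, d) stands for the form a X^3 + b X^2 Y + c X Y^2 + d Y^3, and the
  equations compare it with the product of the three forms p_i X + r_i Y.\<close>

definition factors :: "int \<times> int \<times> int \<times> int \<Rightarrow> (nat \<Rightarrow> complex) \<Rightarrow> (nat \<Rightarrow> complex) \<Rightarrow> bool" where
  "factors F p r \<longleftrightarrow> (case F of (a, b, c, d) \<Rightarrow>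
     of_int a = p 0 * p 1 * p 2 \<and>
     of_int b = p 0 * p 1 * r 2 + p 0 * r 1 * p 2 + r 0 * p 1 * p 2 \<and>
     of_int c = p 0 * r 1 * r 2 + r 0 * p 1 * r 2 + r 0 * r 1 * p 2 \<and>
     of_int d = r 0 * r 1 * r 2)"

text \<open>The coefficients of F(u1 X + v1 Y, u2 X + v2 Y): u and v are the columns of the
  substitution.\<close>

fun subst_form :: "int \<times> int \<times> int \<times> int \<Rightarrow> (int \<times> int) \<times> (int \<times> int) \<Rightarrow> int \<times> int \<times> int \<times> int" where
  "subst_form (a, b, c, d) ((u1, u2), (v1, v2)) =
    (a * u1 * u1 * u1 + b * u1 * u1 * u2 + c * u1 * u2 * u2 + d * u2 * u2 * u2,
     3 * a * u1 * u1 * v1 + b * (u1 * u1 * v2 + 2 * u1 * u2 * v1)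
       + c * (2 * u1 * u2 * v2 + u2 * u2 * v1) + 3 * d * u2 * u2 * v2,
     3 * a * u1 * v1 * v1 + b * (2 * u1 * v1 * v2 + v1 * v1 * u2)
       + c * (u1 * v2 * v2 + 2 * u2 * v1 * v2) + 3 * d * u2 * v2 * v2,
     a * v1 * v1 * v1 + b * v1 * v1 * v2 + c * v1 * v2 * v2 + d * v2 * v2 * v2)"

text \<open>The discriminant of a form as a polynomial in its coefficients; it stays meaningful for
  a = 0, which occurs among representatives.\<close>

fun cubic_disc :: "int \<times> int \<times> int \<times> int \<Rightarrow> int" where
  "cubic_disc (a, b, c, d) =
     b^2 * c^2 - 4 * a * c^3 - 4 * b^3 * d - 27 * a^2 * d^2 + 18 * a * b * c * d"

lemma factors_subst_form:
  assumes "factors F p r"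
  shows "factors (subst_form F (u, v)) (lin p r u) (lin p r v)"
proof -
  obtain a b c d where F: "F = (a, b, c, d)" by (cases F)
  obtain u1 u2 v1 v2 where uv: "u = (u1, u2)" "v = (v1, v2)" by (cases u, cases v)
  show ?thesis
    using assms unfolding F uv
    by (simp add: factors_def lin_def, intro conjI) (simp_all add: algebra_simps)
qed

text \<open>This lets identities between substituted cubic forms be checked on their linear factors,
  without expanding cubics.\<close>

lemma factors_unique:
  assumes "factors F p r" "factors F' p r"
  shows "F = F'"
  using assms by (cases F; cases F') (auto simp: factors_def simp flip: of_int_eq_iff[where 'a = complex])

lemma disc_of_product:
  fixes p0 p1 p2 r0 r1 r2 :: complex
  assumes "a = p0 * p1 * p2" "b = p0 * p1 * r2 + p0 * r1 * p2 + r0 * p1 * p2"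
    "c = p0 * r1 * r2 + r0 * p1 * r2 + r0 * r1 * p2" "d = r0 * r1 * r2"
  shows "b^2 * c^2 - 4 * a * c^3 - 4 * b^3 * d - 27 * a^2 * d^2 + 18 * a * b * c * d =
    ((p0 * r1 - p1 * r0) * (p0 * r2 - p2 * r0) * (p1 * r2 - p2 * r1))\<^sup>2"
  unfolding assms by (simp add: algebra_simps power2_eq_square power3_eq_cube)

lemma cubic_disc_factors:
  assumes "factors F p r"
  shows "of_int (cubic_disc F) =
    ((p 0 * r 1 - p 1 * r 0) * (p 0 * r 2 - p 2 * r 0) * (p 1 * r 2 - p 2 * r 1))\<^sup>2"
proof -
  obtain a b c d where F: "F = (a, b, c, d)" by (cases F)
  show ?thesis using assms unfolding F factors_def prod.case
    by (elim conjE) (simp only: cubic_disc.simps of_int_add of_int_diff of_int_mult of_int_power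
      of_int_numeral disc_of_product)
qed

lemma abs_cubic_disc_balanced:
  assumes "factors F p r" "balanced p r \<kappa>"
  shows "real_of_int \<bar>cubic_disc F\<bar> = \<kappa> ^ 6"
proof -
  have b: "cmod (p 0 * r 1 - p 1 * r 0) = \<kappa>" "cmod (p 0 * r 2 - p 2 * r 0) = \<kappa>"
    "cmod (p 1 * r 2 - p 2 * r 1) = \<kappa>"
    using assms(2) unfolding balanced_def by auto
  have "real_of_int \<bar>cubic_disc F\<bar> = cmod (of_int (cubic_disc F))" by simp
  also have "\<dots> = \<kappa> ^ 6" unfolding cubic_disc_factors[OF assms(1)]
    unfolding norm_power norm_mult b by (simp add: power_mult_distrib flip: power_add)
  finally show ?thesis .
qed

lemma lin_lin:
  "lin (lin p r u) (lin p r v) w = lin p r (fst w * fst u + snd w * fst v, fst w * snd u + snd w * snd v)"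
  by (rule ext) (simp add: lin_def algebra_simps)

lemma lin_unit: "lin p r (1, 0) = p" "lin p r (0, 1) = r"
  by (auto simp: lin_def)

text \<open>The second substitution is the adjugate matrix, written by columns. With determinant 1
  it is the inverse, so a form is recovered from its representative.\<close>

lemma subst_form_inverse:
  assumes "factors F p r" "(u, v) \<in> SL2"
  shows "subst_form (subst_form F (u, v)) ((snd v, - snd u), (- fst v, fst u)) = F"
    "((snd v, - snd u), (- fst v, fst u)) \<in> SL2"
proof -
  have d: "fst u * snd v - fst v * snd u = 1" using assms(2) by (simp add: SL2_def det2_def mult.commute)
  have "factors (subst_form (subst_form F (u, v)) ((snd v, - snd u), (- fst v, fst u)))
    (lin (lin p r u) (lin p r v) (snd v, - snd u)) (lin (lin p r u) (lin p r v) (- fst v, fst u))"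
    using assms(1) by (intro factors_subst_form)
  also have "lin (lin p r u) (lin p r v) (snd v, - snd u) = p"
    using d by (simp add: lin_lin lin_unit mult.commute)
  also have "lin (lin p r u) (lin p r v) (- fst v, fst u) = r"
    using d by (simp add: lin_lin lin_unit mult.commute)
  finally show "subst_form (subst_form F (u, v)) ((snd v, - snd u), (- fst v, fst u)) = F"
    using factors_unique assms(1) by blast
  show "((snd v, - snd u), (- fst v, fst u)) \<in> SL2" using d by (simp add: SL2_def det2_def algebra_simps)
qed

lemma balanced_lin:
  assumes "balanced p r \<kappa>" "(u, v) \<in> SL2"
  shows "balanced (lin p r u) (lin p r v) \<kappa>"
  unfolding balanced_def
proof (intro allI impI)
  fix i j :: nat assume "i < 3" "j < 3" "i \<noteq> j"
  then have "cmod (p i * r j - p j * r i) = \<kappa>" using assms(1) by (simp add: balanced_def)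
  moreover have "lin p r u i * lin p r v j - lin p r u j * lin p r v i = p i * r j - p j * r i"
    using lin_det2[of p r u i v j] assms(2) by (simp add: SL2_def mult.commute)
  ultimately show "cmod (lin p r u i * lin p r v j - lin p r u j * lin p r v i) = \<kappa>" by simp
qed

text \<open>At (1,0), (0,1), (1,1), (1,-1) the substituted form is at most 4H, the sum of its
  coefficient bounds; \<open>prod_max_le\<close> contributes the factor 27.\<close>

lemma prod_linmax_le:
  assumes "factors F p r" and "subst_form F (u, v) = (a, b, c, d)"
    and "\<bar>real_of_int a\<bar> \<le> H" "\<bar>real_of_int b\<bar> \<le> H" "\<bar>real_of_int c\<bar> \<le> H" "\<bar>real_of_int d\<bar> \<le> H"
  shows "linmax p r u v 0 * linmax p r u v 1 * linmax p r u v 2 \<le> 108 * H"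
proof -
  let ?P = "lin p r u" and ?R = "lin p r v"
  have f: "of_int a = ?P 0 * ?P 1 * ?P 2" "of_int d = ?R 0 * ?R 1 * ?R 2"
    "of_int b = ?P 0 * ?P 1 * ?R 2 + ?P 0 * ?R 1 * ?P 2 + ?R 0 * ?P 1 * ?P 2"
    "of_int c = ?P 0 * ?R 1 * ?R 2 + ?R 0 * ?P 1 * ?R 2 + ?R 0 * ?R 1 * ?P 2"
    using factors_subst_form[OF assms(1), of u v] assms(2) by (auto simp: factors_def)
  have s: "(?P 0 + ?R 0) * (?P 1 + ?R 1) * (?P 2 + ?R 2) = of_int (a + b + c + d)"
    "(?P 0 - ?R 0) * (?P 1 - ?R 1) * (?P 2 - ?R 2) = of_int (a - b + c - d)"
    by (simp_all add: f algebra_simps)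
  have "linmax p r u v 0 * linmax p r u v 1 * linmax p r u v 2 \<le> 27 * (4 * H)"
    unfolding linmax_def
  proof (rule prod_max_le)
    show "cmod (?P 0 * ?P 1 * ?P 2) \<le> 4 * H" "cmod (?R 0 * ?R 1 * ?R 2) \<le> 4 * H"
      unfolding f[symmetric] norm_of_int using assms by auto
    show "cmod ((?P 0 + ?R 0) * (?P 1 + ?R 1) * (?P 2 + ?R 2)) \<le> 4 * H"
      "cmod ((?P 0 - ?R 0) * (?P 1 - ?R 1) * (?P 2 - ?R 2)) \<le> 4 * H"
      unfolding s norm_of_int using assms(3-6) by (auto simp: abs_le_iff)
  qed
  then show ?thesis by simp
qed

text \<open>Reality of \<open>hprod p r\<close> makes the positive definite form \<open>\<Sum>i<3. \<bar>p i * X + r i * Y\<bar>\<^sup>2\<close> have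
  discriminant exactly \<open>- 12 * \<kappa>\<^sup>2\<close>, by the Lagrange identity.\<close>

definition hprod :: "(nat \<Rightarrow> complex) \<Rightarrow> (nat \<Rightarrow> complex) \<Rightarrow> complex" where
  "hprod P R = (\<Sum>i<3. P i * cnj (R i))"

section \<open>Complex factorisation with equal determinants\<close>

lemma cubic_complex_roots:
  fixes a b c d :: complex
  assumes "a \<noteq> 0"
  obtains x y z where "b = - a * (x + y + z)" "c = a * (x * y + x * z + y * z)" "d = - a * (x * y * z)"
proof -
  let ?q = "[:d, c, b, a:]"
  obtain A where A: "size A = degree ?q" "?q = smult (lead_coeff ?q) (\<Prod>x\<in>#A. [:- x, 1:])"
    using alg_closed_imp_factorization[of ?q] assms by auto
  have "size A = Suc (Suc (Suc 0))" using A(1) assms by simp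
  then obtain x y z where xyz: "A = {#x, y, z#}"
    by (metis size_eq_Suc_imp_eq_union size_eq_0_iff_empty nat.inject size_add_mset)
  have "?q = smult a ([:- x, 1:] * ([:- y, 1:] * [:- z, 1:]))"
    using A(2) assms by (simp add: xyz)
  then show ?thesis by (intro that[of x y z]) (auto simp: algebra_simps)
qed

text \<open>Conjugation permutes the three points, and the weight of each depends only on the
  distance of the other two, so the sum is fixed by conjugation. Up to a real factor and conjugation
  this sum is \<open>hprod p r\<close> for the balanced factorisation.\<close>

lemma conjugate_roots_weighted_sum_real:
  fixes x y z :: complex
  assumes "x \<noteq> y" "x \<noteq> z" "y \<noteq> z"
    and "cnj x \<in> {x, y, z}" "cnj y \<in> {x, y, z}" "cnj z \<in> {x, y, z}"
  shows "of_real ((cmod (y - z))\<^sup>2) * x + of_real ((cmod (x - z))\<^sup>2) * y + of_real ((cmod (x - y))\<^sup>2) * z \<in> \<real>"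
proof -
  have cm: "cmod (s - t) = cmod (cnj s - cnj t)" for s t
    by (metis complex_cnj_diff complex_mod_cnj)
  consider "cnj x = x" "cnj y = y" "cnj z = z" | "cnj x = x" "cnj y = z" "cnj z = y"
    | "cnj x = y" "cnj y = x" "cnj z = z" | "cnj x = z" "cnj y = y" "cnj z = x"
    using assms by (smt (verit) complex_cnj_cnj insert_iff singletonD)
  then show ?thesis
  proof cases
    case 1
    then show ?thesis by (simp add: Reals_cnj_iff)
  next
    case 2
    then show ?thesis using cm[of x y] by (simp add: Reals_cnj_iff)
  next
    case 3
    then show ?thesis using cm[of x z] by (simp add: Reals_cnj_iff)
  next
    case 4
    then show ?thesis using cm[of x y] by (simp add: Reals_cnj_iff norm_minus_commute)
  qed
qed

lemma balanced_factors_exist: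
  assumes a: "a \<noteq> 0" and disc: "cubic_disc (a, b, c, d) \<noteq> 0"
  obtains p r \<kappa> where "factors (a, b, c, d) p r" "balanced p r \<kappa>" "\<kappa> > 0" "hprod p r \<in> \<real>"
proof -
  obtain x y z :: complex where xyz: "of_int b = - of_int a * (x + y + z)"
    "of_int c = of_int a * (x * y + x * z + y * z)" "of_int d = - of_int a * (x * y * z)"
    using cubic_complex_roots[of "of_int a" "of_int b" "of_int c" "of_int d"] a by auto
  \<comment> \<open>The plain factorisation a (X - xY)(X - yY)(X - zY) serves only to see from the
    discriminant that the roots are distinct.\<close>
  have "factors (a, b, c, d) (\<lambda>i. if i = 0 then of_int a else 1)
     (\<lambda>i. if i = 0 then - of_int a * x else if i = 1 then - y else - z)"
    unfolding factors_def by (simp add: xyz algebra_simps)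
  from cubic_disc_factors[OF this] disc have dist: "x \<noteq> y" "x \<noteq> z" "y \<noteq> z"
    by (auto simp del: cubic_disc.simps)
  have poly: "of_int a * t ^ 3 + of_int b * t\<^sup>2 + of_int c * t + of_int d = of_int a * ((t - x) * (t - y) * (t - z))" for t
    unfolding xyz by (simp add: algebra_simps power2_eq_square power3_eq_cube)
  have cnj_root: "cnj t \<in> {x, y, z}" if "t \<in> {x, y, z}" for t
  proof -
    have "of_int a * ((cnj t - x) * (cnj t - y) * (cnj t - z)) =
       cnj (of_int a * t ^ 3 + of_int b * t\<^sup>2 + of_int c * t + of_int d)"
      by (simp flip: poly)
    also have "\<dots> = 0" using that unfolding poly by auto
    finally show ?thesis using a by simp
  qed
  \<comment> \<open>Weighting the factor of each root by the distance between the other two makes all determinants equal.\<close>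
  define X Y Z where "X = cmod (y - z)" and "Y = cmod (x - z)" and "Z = cmod (x - y)"
  have pos: "X > 0" "Y > 0" "Z > 0" using dist by (auto simp: X_def Y_def Z_def)
  \<comment> \<open>The weights s X, s Y, s Z must multiply to a. The real cube root exists for
    either sign of a, and real weights are what makes \<open>hprod p r\<close> real.\<close>
  define s where "s = root 3 (of_int a / (X * Y * Z))"
  have s3: "s ^ 3 * (X * Y * Z) = of_int a"
    using pos by (simp add: s_def odd_real_root_pow)
  then have s0: "s \<noteq> 0" using a by auto
  define p r where "p = (\<lambda>i::nat. complex_of_real (s * (if i = 0 then X else if i = 1 then Y else Z)))"
    and "r = (\<lambda>i::nat. - complex_of_real (s * (if i = 0 then X else if i = 1 then Y else Z)) *
       (if i = 0 then x else if i = 1 then y else z))"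
  define w where "w = (\<lambda>i::nat. s * (if i = 0 then X else if i = 1 then Y else Z))"
  show ?thesis
  proof
    have sa: "complex_of_real s ^ 3 * (of_real X * of_real Y * of_real Z) = of_int a"
      using s3 by (metis of_real_mult of_real_of_int_eq of_real_power)
    show "factors (a, b, c, d) p r"
      unfolding factors_def p_def r_def prod.case xyz
      by (simp add: algebra_simps power3_eq_cube flip: sa)
    show "balanced p r (s\<^sup>2 * (X * Y * Z))"
      unfolding balanced_def
    proof (intro allI impI)
      fix i j :: nat assume ij: "i < 3" "j < 3" "i \<noteq> j"
      have e: "p i * r j - p j * r i = of_real (w i * w j) *
        ((if i = 0 then x else if i = 1 then y else z) - (if j = 0 then x else if j = 1 then y else z))"
        unfolding p_def r_def w_def by (simp add: algebra_simps)
      have "i = 0 \<or> i = 1 \<or> i = 2" "j = 0 \<or> j = 1 \<or> j = 2" using ij by auto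
      then show "cmod (p i * r j - p j * r i) = s\<^sup>2 * (X * Y * Z)"
        unfolding e norm_mult norm_of_real using ij(3) pos
        by (auto simp: w_def abs_mult X_def Y_def Z_def norm_minus_commute power2_eq_square)
    qed
    show "s\<^sup>2 * (X * Y * Z) > 0" using pos s0 by simp
    have "hprod p r = - (of_real (s\<^sup>2) * cnj (of_real (X\<^sup>2) * x + of_real (Y\<^sup>2) * y + of_real (Z\<^sup>2) * z))"
      unfolding hprod_def p_def r_def by (simp add: numeral_3_eq_3 algebra_simps power2_eq_square)
    moreover have "of_real (X\<^sup>2) * x + of_real (Y\<^sup>2) * y + of_real (Z\<^sup>2) * z \<in> \<real>"
      unfolding X_def Y_def Z_def
      using dist cnj_root by (intro conjugate_roots_weighted_sum_real) auto
    ultimately show "hprod p r \<in> \<real>"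
      by (metis Reals_cnj_iff Reals_minus Reals_mult Reals_of_real)
  qed
qed

section \<open>Reduction\<close>

definition qnorm :: "(nat \<Rightarrow> complex) \<Rightarrow> real" where
  "qnorm P = (\<Sum>i<3. (cmod (P i))\<^sup>2)"

lemma hprod_self: "hprod P P = of_real (qnorm P)"
  by (simp add: hprod_def qnorm_def complex_norm_square del: of_real_power)

lemma lagrange_identity:
  assumes "balanced P R \<kappa>"
  shows "qnorm P * qnorm R = (cmod (hprod P R))\<^sup>2 + 3 * \<kappa>\<^sup>2"
proof -
  have b: "cmod (P 0 * R 1 - P 1 * R 0) = \<kappa>" "cmod (P 0 * R 2 - P 2 * R 0) = \<kappa>"
    "cmod (P 1 * R 2 - P 2 * R 1) = \<kappa>"
    using assms unfolding balanced_def by auto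
  have s: "sum f {..<3::nat} = f 0 + f 1 + f 2" for f :: "nat \<Rightarrow> 'a::comm_monoid_add"
    by (simp add: numeral_3_eq_3 numeral_2_eq_2)
  have "complex_of_real (qnorm P * qnorm R) = of_real ((cmod (hprod P R))\<^sup>2
      + ((cmod (P 0 * R 1 - P 1 * R 0))\<^sup>2 + (cmod (P 0 * R 2 - P 2 * R 0))\<^sup>2 + (cmod (P 1 * R 2 - P 2 * R 1))\<^sup>2))"
    unfolding qnorm_def hprod_def s of_real_add of_real_mult complex_norm_square complex_cnj_add
      complex_cnj_mult complex_cnj_diff complex_cnj_cnj
    by (simp add: algebra_simps)
  then have "qnorm P * qnorm R = (cmod (hprod P R))\<^sup>2
      + ((cmod (P 0 * R 1 - P 1 * R 0))\<^sup>2 + (cmod (P 0 * R 2 - P 2 * R 0))\<^sup>2 + (cmod (P 1 * R 2 - P 2 * R 1))\<^sup>2)"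
    by (simp only: of_real_eq_iff)
  then show ?thesis unfolding b by simp
qed

lemma qnorm_add: "qnorm (\<lambda>i. P i + R i) = qnorm P + qnorm R + 2 * Re (hprod P R)"
  and qnorm_diff: "qnorm (\<lambda>i. P i - R i) = qnorm P + qnorm R - 2 * Re (hprod P R)"
  and qnorm_uminus: "qnorm (\<lambda>i. - P i) = qnorm P"
  unfolding qnorm_def hprod_def
  by (simp_all add: cmod_power2 sum.distrib sum_subtractf sum_distrib_left power2_sum power2_diff algebra_simps)

lemma hprod_lin_real:
  assumes "hprod p r \<in> \<real>"
  shows "hprod (lin p r u) (lin p r v) \<in> \<real>"
proof -
  have h: "hprod r p = cnj (hprod p r)" by (simp add: hprod_def mult.commute)
  have e: "hprod (lin p r u) (lin p r v) = of_int (fst u * fst v) * hprod p p + of_int (snd u * snd v) * hprod r r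
    + of_int (fst u * snd v) * hprod p r + of_int (snd u * fst v) * hprod r p"
    by (simp add: hprod_def lin_def sum_distrib_left sum.distrib algebra_simps)
  have "cnj (hprod p r) \<in> \<real>" using assms by (simp add: Reals_cnj_iff)
  then show ?thesis unfolding e h hprod_self using assms by (intro Reals_add Reals_mult) auto
qed

text \<open>The forms 0 and 1 have determinant of modulus \<kappa> > 0, so by Cramer's rule their
  values bound the coordinates of w.\<close>

lemma finite_qnorm_le:
  assumes b: "balanced p r \<kappa>" and \<kappa>: "\<kappa> > 0"
  shows "finite {w. qnorm (lin p r w) \<le> C}"
proof -
  define B where "B = (cmod (r 1) + cmod (r 0) + cmod (p 0) + cmod (p 1)) * sqrt C / \<kappa>"
  have "{w. qnorm (lin p r w) \<le> C} \<subseteq> {- \<lfloor>B\<rfloor>..\<lfloor>B\<rfloor>} \<times> {- \<lfloor>B\<rfloor>..\<lfloor>B\<rfloor>}"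
  proof
    fix w assume "w \<in> {w. qnorm (lin p r w) \<le> C}"
    then have q: "qnorm (lin p r w) \<le> C" by simp
    have l: "cmod (lin p r w i) \<le> sqrt C" if "i < 3" for i
    proof (rule real_le_rsqrt)
      have "(cmod (lin p r w i))\<^sup>2 \<le> qnorm (lin p r w)"
        unfolding qnorm_def using that by (intro member_le_sum) auto
      then show "(cmod (lin p r w i))\<^sup>2 \<le> C" using q by simp
    qed
    have C0: "0 \<le> sqrt C" using l[of 0] norm_ge_zero order_trans by (metis zero_less_numeral)
    have \<kappa>B: "\<kappa> * B = (cmod (r 1) + cmod (r 0) + cmod (p 0) + cmod (p 1)) * sqrt C"
      using \<kappa> by (simp add: B_def)
    have \<kappa>01: "cmod (p 0 * r 1 - p 1 * r 0) = \<kappa>" using b by (simp add: balanced_def)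
    have "\<kappa> * \<bar>of_int (fst w)\<bar> = cmod (r 1 * lin p r w 0 - r 0 * lin p r w 1)"
    proof -
      have "r 1 * lin p r w 0 - r 0 * lin p r w 1 = (p 0 * r 1 - p 1 * r 0) * of_int (fst w)"
        by (simp add: lin_def algebra_simps)
      then show ?thesis by (simp only: norm_mult norm_of_int \<kappa>01)
    qed
    also have "\<dots> \<le> cmod (r 1) * cmod (lin p r w 0) + cmod (r 0) * cmod (lin p r w 1)"
      by (metis norm_mult norm_triangle_ineq4)
    also have "\<dots> \<le> cmod (r 1) * sqrt C + cmod (r 0) * sqrt C"
      using l by (intro add_mono mult_left_mono) auto
    also have "\<dots> \<le> \<kappa> * B" unfolding \<kappa>B using C0 by (simp add: algebra_simps)
    finally have 1: "\<bar>of_int (fst w)\<bar> \<le> B" using \<kappa> by simp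
    have "\<kappa> * \<bar>of_int (snd w)\<bar> = cmod (p 0 * lin p r w 1 - p 1 * lin p r w 0)"
    proof -
      have "p 0 * lin p r w 1 - p 1 * lin p r w 0 = (p 0 * r 1 - p 1 * r 0) * of_int (snd w)"
        by (simp add: lin_def algebra_simps)
      then show ?thesis by (simp only: norm_mult norm_of_int \<kappa>01)
    qed
    also have "\<dots> \<le> cmod (p 0) * cmod (lin p r w 1) + cmod (p 1) * cmod (lin p r w 0)"
      by (metis norm_mult norm_triangle_ineq4)
    also have "\<dots> \<le> cmod (p 0) * sqrt C + cmod (p 1) * sqrt C"
      using l by (intro add_mono mult_left_mono) auto
    also have "\<dots> \<le> \<kappa> * B" unfolding \<kappa>B using C0 by (simp add: algebra_simps)
    finally have 2: "\<bar>of_int (snd w)\<bar> \<le> B" using \<kappa> by simp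
    have "\<bar>fst w\<bar> \<le> \<lfloor>B\<rfloor>" "\<bar>snd w\<bar> \<le> \<lfloor>B\<rfloor>" using 1 2 by (auto simp: le_floor_iff)
    then show "w \<in> {- \<lfloor>B\<rfloor>..\<lfloor>B\<rfloor>} \<times> {- \<lfloor>B\<rfloor>..\<lfloor>B\<rfloor>}"
      by (cases w) auto
  qed
  then show ?thesis by (rule finite_subset) auto
qed

lemma qnorm_nonneg: "qnorm P \<ge> 0"
  by (simp add: qnorm_def sum_nonneg)

lemma lin_add: "lin p r (fst u + fst v, snd u + snd v) = (\<lambda>i. lin p r u i + lin p r v i)"
  and lin_diff: "lin p r (fst u - fst v, snd u - snd v) = (\<lambda>i. lin p r u i - lin p r v i)"
  and lin_uminus: "lin p r (- fst u, - snd u) = (\<lambda>i. - lin p r u i)"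
  by (auto simp: lin_def algebra_simps)

text \<open>Gauss reduction by minimality: q(u) + q(v) attains its minimum over \<open>SL2\<close>,
  since only finitely many pairs stay below its value at the identity. Comparing the minimal pair
  with (u, v + u), (u, v - u), (u + v, v), (u - v, v) bounds the cross term by both q(u) and
  q(v).\<close>

lemma reduced_basis_exists:
  assumes b: "balanced p r \<kappa>" and \<kappa>: "\<kappa> > 0"
  obtains u v where "(u, v) \<in> SL2"
    "\<bar>2 * Re (hprod (lin p r u) (lin p r v))\<bar> \<le> qnorm (lin p r u)"
    "qnorm (lin p r u) \<le> qnorm (lin p r v)"
proof -
  define q where "q w = qnorm (lin p r w)" for w
  define f where "f g = q (fst g) + q (snd g)" for g :: "(int \<times> int) \<times> (int \<times> int)"
  have q0: "q w \<ge> 0" for w by (simp add: q_def qnorm_nonneg)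
  define C where "C = f ((1, 0), (0, 1))"
  define T where "T = {g \<in> SL2. f g \<le> C}"
  have "T \<subseteq> {w. q w \<le> C} \<times> {w. q w \<le> C}"
  proof
    fix g assume "g \<in> T"
    then have "q (fst g) + q (snd g) \<le> C" by (simp add: T_def f_def)
    then show "g \<in> {w. q w \<le> C} \<times> {w. q w \<le> C}"
      using q0[of "fst g"] q0[of "snd g"] by (cases g) auto
  qed
  moreover have "finite {w. q w \<le> C}" unfolding q_def using finite_qnorm_le[OF b \<kappa>] .
  ultimately have "finite T" by (meson finite_SigmaI finite_subset)
  moreover have id: "((1, 0), (0, 1)) \<in> T" by (simp add: T_def SL2_def det2_def C_def)
  ultimately have "Min (f ` T) \<in> f ` T" by (intro Min_in) auto
  then obtain g where g: "g \<in> T" "f g = Min (f ` T)" by auto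
  have "f g \<le> f h" if "h \<in> SL2" for h
  proof (cases "h \<in> T")
    case True
    then show ?thesis unfolding g(2) using \<open>finite T\<close> by (intro Min_le) auto
  next
    case False
    then show ?thesis using that g(1) by (simp add: T_def)
  qed
  moreover obtain u v where uv: "g = (u, v)" by (cases g)
  ultimately have min: "q u + q v \<le> q u' + q v'" if "(u', v') \<in> SL2" for u' v'
    using that by (fastforce simp: f_def)
  have SL: "(u, v) \<in> SL2" using g(1) by (simp add: uv T_def)
  have d: "fst u * snd v - fst v * snd u = 1" using SL by (simp add: SL2_def det2_def mult.commute)
  define h where "h = Re (hprod (lin p r u) (lin p r v))"
  have hc: "Re (hprod (lin p r v) (lin p r u)) = h"
  proof -
    have "hprod (lin p r v) (lin p r u) = cnj (hprod (lin p r u) (lin p r v))"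
      by (simp add: hprod_def mult.commute)
    then show ?thesis by (simp add: h_def)
  qed
  have "q u + q v \<le> q u + q (fst u + fst v, snd u + snd v)"
    by (rule min) (use d in \<open>simp add: SL2_def det2_def algebra_simps\<close>)
  then have 1: "0 \<le> q u + 2 * h" unfolding q_def lin_add qnorm_add by (simp add: h_def)
  have "q u + q v \<le> q u + q (fst v - fst u, snd v - snd u)"
    by (rule min) (use d in \<open>simp add: SL2_def det2_def algebra_simps\<close>)
  then have 2: "0 \<le> q u - 2 * h" unfolding q_def lin_diff qnorm_diff by (simp add: hc)
  have "q u + q v \<le> q (fst u + fst v, snd u + snd v) + q v"
    by (rule min) (use d in \<open>simp add: SL2_def det2_def algebra_simps\<close>)
  then have 3: "0 \<le> q v + 2 * h" unfolding q_def lin_add qnorm_add by (simp add: h_def)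
  have "q u + q v \<le> q (fst u - fst v, snd u - snd v) + q v"
    by (rule min) (use d in \<open>simp add: SL2_def det2_def algebra_simps\<close>)
  then have 4: "0 \<le> q v - 2 * h" unfolding q_def lin_diff qnorm_diff by (simp add: h_def)
  show ?thesis
  proof (cases "q u \<le> q v")
    case True
    then show ?thesis using 1 2 SL by (intro that[of u v]) (auto simp: q_def h_def)
  next
    case False
    \<comment> \<open>Passing to (v, -u) exchanges the two norms, keeps the determinant and only
      flips the sign of the cross term.\<close>
    have "hprod (lin p r v) (lin p r (- fst u, - snd u)) = - hprod (lin p r v) (lin p r u)"
      unfolding lin_uminus by (simp add: hprod_def sum_negf)
    moreover have "qnorm (lin p r (- fst u, - snd u)) = q u"
      unfolding lin_uminus qnorm_uminus q_def ..
    moreover have "(v, (- fst u, - snd u)) \<in> SL2" using d by (simp add: SL2_def det2_def algebra_simps)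
    ultimately show ?thesis using False 3 4 hc
      by (intro that[of v "(- fst u, - snd u)"]) (auto simp: q_def)
  qed
qed

text \<open>With s <= t the norms of the two coefficient vectors, reducedness gives h^2 <= s^2 t^2 /
  4. The Lagrange identity then yields st <= 2\<kappa>. The coefficients are O(s^3), O(s^2 t), O(s
  t^2), O(t^3), so a product in which t occurs no more often than s is bounded by a power of st. The
  quantity a c^3 is included because b may vanish, and then b c says nothing about c. The constants
  are 72 = 9 * 8 and 1728 = 27 * 64.\<close>

lemma reduced_form_exists:
  assumes F: "factors F p r" and b: "balanced p r \<kappa>" and \<kappa>: "\<kappa> > 0" and re: "hprod p r \<in> \<real>"
  obtains u v a b c d where "(u, v) \<in> SL2" "subst_form F (u, v) = (a, b, c, d)"
    "\<bar>real_of_int (a * d)\<bar> \<le> 72 * \<kappa> ^ 3" "\<bar>real_of_int (b * c)\<bar> \<le> 72 * \<kappa> ^ 3"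
    "(real_of_int a)\<^sup>2 \<le> 72 * \<kappa> ^ 3" "(real_of_int b)\<^sup>2 \<le> 72 * \<kappa> ^ 3"
    "\<bar>real_of_int a\<bar> * \<bar>real_of_int c\<bar> ^ 3 \<le> 1728 * \<kappa> ^ 6"
proof -
  obtain u v where uv: "(u, v) \<in> SL2"
    "\<bar>2 * Re (hprod (lin p r u) (lin p r v))\<bar> \<le> qnorm (lin p r u)"
    "qnorm (lin p r u) \<le> qnorm (lin p r v)"
    using reduced_basis_exists[OF b \<kappa>] by blast
  define P R where "P = lin p r u" and "R = lin p r v"
  define h where "h = Re (hprod P R)"
  define s t where "s = sqrt (qnorm P)" and "t = sqrt (qnorm R)"
  have st0: "0 \<le> s" "0 \<le> t" "s \<le> t" using uv by (auto simp: s_def t_def P_def R_def qnorm_nonneg)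
  have sq: "s\<^sup>2 = qnorm P" "t\<^sup>2 = qnorm R" by (auto simp: s_def t_def qnorm_nonneg)
  have h: "\<bar>2 * h\<bar> \<le> s\<^sup>2" using uv by (simp add: h_def sq P_def R_def)
  have "hprod P R \<in> \<real>" unfolding P_def R_def using re by (rule hprod_lin_real)
  then have "hprod P R = of_real h" by (simp add: h_def)
  then have "s\<^sup>2 * t\<^sup>2 = h\<^sup>2 + 3 * \<kappa>\<^sup>2"
    using lagrange_identity[of P R \<kappa>] balanced_lin[OF b uv(1)] by (simp add: sq P_def R_def)
  moreover have "(2 * h)\<^sup>2 \<le> s\<^sup>2 * t\<^sup>2"
  proof -
    have "(2 * h)\<^sup>2 = \<bar>2 * h\<bar> * \<bar>2 * h\<bar>" by (simp add: power2_eq_square)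
    also have "\<dots> \<le> s\<^sup>2 * s\<^sup>2" using h by (intro mult_mono) auto
    also have "\<dots> \<le> s\<^sup>2 * t\<^sup>2" using st0 by (intro mult_left_mono power_mono) auto
    finally show ?thesis .
  qed
  ultimately have "(s * t)\<^sup>2 \<le> (2 * \<kappa>)\<^sup>2" unfolding power_mult_distrib by simp
  then have st: "s * t \<le> 2 * \<kappa>" by (rule power2_le_imp_le) (use \<kappa> in simp)
  have Ps: "cmod (P i) \<le> s" and Rt: "cmod (R i) \<le> t" if "i < 3" for i
    unfolding s_def t_def qnorm_def using that
    by (auto intro!: real_le_rsqrt member_le_sum)
  obtain a b c d where f: "subst_form F (u, v) = (a, b, c, d)" by (cases "subst_form F (u, v)")
  have fac: "of_int a = P 0 * P 1 * P 2" "of_int d = R 0 * R 1 * R 2"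
    "of_int b = P 0 * P 1 * R 2 + P 0 * R 1 * P 2 + R 0 * P 1 * P 2"
    "of_int c = P 0 * R 1 * R 2 + R 0 * P 1 * R 2 + R 0 * R 1 * P 2"
    using factors_subst_form[OF F, of u v] f by (auto simp: factors_def P_def R_def)
  have tr: "cmod (x * y * z) \<le> X * Y * Z" if "cmod x \<le> X" "cmod y \<le> Y" "cmod z \<le> Z" for x y z X Y Z
  proof -
    have "0 \<le> X" "0 \<le> Y" "0 \<le> Z" using that norm_ge_zero order_trans by blast+
    then show ?thesis unfolding norm_mult using that by (intro mult_mono) auto
  qed
  have a: "\<bar>real_of_int a\<bar> \<le> s * s * s"
    using tr[OF Ps Ps Ps, of 0 1 2] unfolding fac(1)[symmetric] by simp
  have d: "\<bar>real_of_int d\<bar> \<le> t * t * t"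
    using tr[OF Rt Rt Rt, of 0 1 2] unfolding fac(2)[symmetric] by simp
  have "cmod (of_int b) \<le> s * s * t + s * t * s + t * s * s"
    unfolding fac using Ps Rt by (intro norm_triangle_le add_mono tr) auto
  then have b: "\<bar>real_of_int b\<bar> \<le> 3 * (s * s * t)" by (simp add: mult_ac)
  have "cmod (of_int c) \<le> s * t * t + t * s * t + t * t * s"
    unfolding fac using Ps Rt by (intro norm_triangle_le add_mono tr) auto
  then have c: "\<bar>real_of_int c\<bar> \<le> 3 * (s * t * t)" by (simp add: mult_ac)
  have st3: "(s * t) ^ 3 \<le> 8 * \<kappa> ^ 3"
    using power_mono[OF st, of 3] st0 by (simp add: power_mult_distrib)
  have \<kappa>3: "\<kappa> ^ 3 > 0" using \<kappa> by simp
  have st6: "(s * t) ^ 6 \<le> 64 * \<kappa> ^ 6"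
    using power_mono[OF st, of 6] st0 by (simp add: power_mult_distrib)
  show ?thesis
  proof (rule that[OF uv(1) f])
    have "\<bar>real_of_int (a * d)\<bar> \<le> (s * s * s) * (t * t * t)"
      unfolding of_int_mult abs_mult using a d st0 by (intro mult_mono) auto
    also have "\<dots> = (s * t) ^ 3" by (simp add: power3_eq_cube)
    finally show "\<bar>real_of_int (a * d)\<bar> \<le> 72 * \<kappa> ^ 3" using st3 \<kappa>3 by linarith
    have "\<bar>real_of_int (b * c)\<bar> \<le> (3 * (s * s * t)) * (3 * (s * t * t))"
      unfolding of_int_mult abs_mult using b c st0 by (intro mult_mono) auto
    also have "\<dots> = 9 * (s * t) ^ 3" by (simp add: power3_eq_cube)
    finally show "\<bar>real_of_int (b * c)\<bar> \<le> 72 * \<kappa> ^ 3" using st3 \<kappa>3 by linarith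
    have "(real_of_int a)\<^sup>2 = \<bar>real_of_int a\<bar> * \<bar>real_of_int a\<bar>" by (simp add: power2_eq_square)
    also have "\<dots> \<le> (s * s * s) * (s * s * s)" using a st0 by (intro mult_mono) auto
    also have "\<dots> \<le> (s * s * s) * (t * t * t)" using st0 by (intro mult_left_mono mult_mono) auto
    also have "\<dots> = (s * t) ^ 3" by (simp add: power3_eq_cube)
    finally show "(real_of_int a)\<^sup>2 \<le> 72 * \<kappa> ^ 3" using st3 \<kappa>3 by linarith
    have "(real_of_int b)\<^sup>2 = \<bar>real_of_int b\<bar> * \<bar>real_of_int b\<bar>" by (simp add: power2_eq_square)
    also have "\<dots> \<le> (3 * (s * s * t)) * (3 * (s * s * t))" using b st0 by (intro mult_mono) auto
    also have "\<dots> \<le> (3 * (s * s * t)) * (3 * (s * t * t))"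
      using st0 by (intro mult_left_mono mult_mono) auto
    also have "\<dots> = 9 * (s * t) ^ 3" by (simp add: power3_eq_cube)
    finally show "(real_of_int b)\<^sup>2 \<le> 72 * \<kappa> ^ 3" using st3 \<kappa>3 by linarith
    have "\<bar>real_of_int a\<bar> * \<bar>real_of_int c\<bar> ^ 3 \<le> (s * s * s) * (3 * (s * t * t)) ^ 3"
      using a c st0 by (intro mult_mono power_mono) auto
    also have "\<dots> = 27 * (s * t) ^ 6" by (simp add: eval_nat_numeral)
    also have "\<dots> \<le> 27 * (64 * \<kappa> ^ 6)" using st6 by simp
    finally show "\<bar>real_of_int a\<bar> * \<bar>real_of_int c\<bar> ^ 3 \<le> 1728 * \<kappa> ^ 6" by simp
  qed
qed

section \<open>Representatives of the classes of cubic forms\<close>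

text \<open>If \<open>a = 0\<close>, the bound on \<open>a * d\<close> says nothing about \<open>d\<close>; there a translation makes \<open>\<bar>c\<bar> \<le> \<bar>b\<bar>\<close>,
  and the discriminant \<open>b\<^sup>2 * c\<^sup>2 - 4 * b ^ 3 * d\<close> controls \<open>d\<close>.\<close>

definition reps :: "real \<Rightarrow> (int \<times> int \<times> int \<times> int) set" where
  "reps D = {(a, b, c, d). (a, d) \<in> hyperbolic_pairs (72 * sqrt D) \<and> (b, c) \<in> hyperbolic_pairs (72 * sqrt D)}
     \<union> {(a, b, c, d). a = 0 \<and> b \<noteq> 0 \<and> \<bar>c\<bar> \<le> \<bar>b\<bar> \<and> (real_of_int b)\<^sup>2 \<le> 72 * sqrt D
          \<and> \<bar>real_of_int (b ^ 3 * d)\<bar> \<le> 1297 * D}"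

lemma abs_le_square_int: "\<bar>real_of_int a\<bar> \<le> (real_of_int a)\<^sup>2"
proof -
  have "\<bar>a\<bar> * 1 \<le> \<bar>a\<bar> * \<bar>a\<bar>" by (cases "a = 0") (simp, intro mult_left_mono, auto)
  then have "\<bar>a\<bar> \<le> a\<^sup>2" by (simp add: power2_eq_square)
  then show ?thesis by (metis of_int_abs of_int_le_iff of_int_power)
qed

lemma translate_middle_coeff:
  fixes b c :: int
  assumes "b \<noteq> 0"
  obtains k where "\<bar>2 * b * k + c\<bar> \<le> \<bar>b\<bar>"
proof -
  \<comment> \<open>Adding |b| before the division centres the remainder: c - 2|b|q lies between
    -|b| and |b|.\<close>
  define q where "q = (c + \<bar>b\<bar>) div (2 * \<bar>b\<bar>)"
  have "(c + \<bar>b\<bar>) mod (2 * \<bar>b\<bar>) = c + \<bar>b\<bar> - 2 * \<bar>b\<bar> * q"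
    unfolding q_def by (simp add: minus_mult_div_eq_mod)
  moreover have "0 \<le> (c + \<bar>b\<bar>) mod (2 * \<bar>b\<bar>)" "(c + \<bar>b\<bar>) mod (2 * \<bar>b\<bar>) < 2 * \<bar>b\<bar>"
    using assms by auto
  moreover have "2 * b * (- sgn b * q) = - (2 * \<bar>b\<bar> * q)"
    by (simp add: abs_sgn mult_ac)
  ultimately show ?thesis by (intro that[of "- sgn b * q"]) linarith
qed

lemma rep_exists:
  assumes F: "factors F p r" and b: "balanced p r \<kappa>" and \<kappa>: "\<kappa> > 0" and re: "hprod p r \<in> \<real>"
    and D: "D \<ge> 1" "\<kappa> ^ 6 \<le> D"
  obtains g where "g \<in> SL2" "subst_form F g \<in> reps D"
proof -
  obtain u v a b c d where uv: "(u, v) \<in> SL2" and f: "subst_form F (u, v) = (a, b, c, d)"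
    and bd: "\<bar>real_of_int (a * d)\<bar> \<le> 72 * \<kappa> ^ 3" "\<bar>real_of_int (b * c)\<bar> \<le> 72 * \<kappa> ^ 3"
    "(real_of_int a)\<^sup>2 \<le> 72 * \<kappa> ^ 3" "(real_of_int b)\<^sup>2 \<le> 72 * \<kappa> ^ 3"
    "\<bar>real_of_int a\<bar> * \<bar>real_of_int c\<bar> ^ 3 \<le> 1728 * \<kappa> ^ 6"
    using reduced_form_exists[OF F assms(2) \<kappa> re] .
  define Y where "Y = 72 * sqrt D"
  have Y1: "Y \<ge> 1" using real_sqrt_ge_1_iff[of D, THEN iffD2, OF D(1)] unfolding Y_def by linarith
  have "\<kappa> ^ 3 \<le> sqrt D" using D(2) by (intro real_le_rsqrt) (simp flip: power_mult)
  then have Y: "72 * \<kappa> ^ 3 \<le> Y" by (simp add: Y_def)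
  have YD: "Y\<^sup>2 = 5184 * D" using D by (simp add: Y_def power_mult_distrib)
  show ?thesis
  proof (cases "a = 0")
    case False
    have "\<bar>real_of_int d\<bar> * 1 \<le> \<bar>real_of_int d\<bar> * \<bar>real_of_int a\<bar>"
      using False by (intro mult_left_mono) auto
    then have dY: "\<bar>real_of_int d\<bar> \<le> Y" using bd(1) Y by (simp add: abs_mult mult.commute)
    \<comment> \<open>If |c| > Y, then |a c^3| > Y^3 >= Y^2 = 5184 D, against the bound 1728
      D.\<close>
    have cY: "\<bar>real_of_int c\<bar> \<le> Y"
    proof (rule ccontr)
      assume *: "\<not> ?thesis"
      have "Y\<^sup>2 * 1 \<le> Y\<^sup>2 * Y" using Y1 by (intro mult_left_mono) auto
      also have "\<dots> = Y ^ 3" by (simp add: power2_eq_square power3_eq_cube)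
      also have "\<dots> < \<bar>real_of_int c\<bar> ^ 3" using * Y1 by (intro power_strict_mono) auto
      also have "\<dots> = 1 * \<bar>real_of_int c\<bar> ^ 3" by simp
      also have "\<dots> \<le> \<bar>real_of_int a\<bar> * \<bar>real_of_int c\<bar> ^ 3"
        using False by (intro mult_right_mono) auto
      also have "\<dots> \<le> 1728 * D" using bd(5) D(2) by linarith
      finally show False using YD D(1) by simp
    qed
    have "\<bar>real_of_int a\<bar> \<le> Y" "\<bar>real_of_int b\<bar> \<le> Y"
      using bd(3,4) Y abs_le_square_int[of a] abs_le_square_int[of b] by linarith+
    then have "subst_form F (u, v) \<in> reps D"
      using bd Y dY cY unfolding f reps_def hyperbolic_pairs_def Y_def by auto
    with uv show ?thesis by (rule that)
  next
    case True
    have fac: "factors (0, b, c, d) (lin p r u) (lin p r v)"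
      using factors_subst_form[OF F, of u v] f True by simp
    have disc: "real_of_int \<bar>cubic_disc (0, b, c, d)\<bar> = \<kappa> ^ 6"
      using abs_cubic_disc_balanced[OF fac balanced_lin[OF assms(2) uv]] .
    then have "cubic_disc (0, b, c, d) \<noteq> 0" using \<kappa> by (auto simp del: cubic_disc.simps)
    then have b0: "b \<noteq> 0" by auto
    obtain k where k: "\<bar>2 * b * k + c\<bar> \<le> \<bar>b\<bar>" using translate_middle_coeff[OF b0] .
    \<comment> \<open>The translation X -> X + kY, which fixes a = 0 and b and moves c to 2bk +
      c.\<close>
    define v' where "v' = (k * fst u + fst v, k * snd u + snd v)"
    define c' d' where "c' = 2 * b * k + c" and "d' = b * k * k + c * k + d"
    have "(u, v') \<in> SL2" using uv by (simp add: SL2_def v'_def det2_def algebra_simps)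
    have "subst_form (0, b, c, d) ((1, 0), (k, 1)) = (0, b, c', d')"
      by (simp add: c'_def d'_def algebra_simps)
    moreover have "lin (lin p r u) (lin p r v) (1, 0) = lin p r u" "lin (lin p r u) (lin p r v) (k, 1) = lin p r v'"
      by (simp_all add: lin_lin v'_def)
    ultimately have fac': "factors (0, b, c', d') (lin p r u) (lin p r v')"
      using factors_subst_form[OF fac, of "(1, 0)" "(k, 1)"] by simp
    then have eq: "subst_form F (u, v') = (0, b, c', d')"
      using factors_subst_form[OF F, of u v'] factors_unique by blast
    have "real_of_int \<bar>cubic_disc (0, b, c', d')\<bar> = \<kappa> ^ 6"
      using abs_cubic_disc_balanced[OF fac' balanced_lin[OF assms(2) \<open>(u, v') \<in> SL2\<close>]] .
    then have "\<bar>real_of_int (b\<^sup>2 * c'\<^sup>2 - 4 * (b ^ 3 * d'))\<bar> \<le> D"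
      using D(2) by simp
    then have "\<bar>real_of_int (b\<^sup>2 * c'\<^sup>2) - 4 * real_of_int (b ^ 3 * d')\<bar> \<le> D"
      by (metis of_int_diff of_int_mult of_int_numeral)
    moreover have "0 \<le> real_of_int (b\<^sup>2 * c'\<^sup>2)" by simp
    \<comment> \<open>The right side will be at most D + 5184 D, and a quarter of 5185 is below
      1297.\<close>
    ultimately have "4 * \<bar>real_of_int (b ^ 3 * d')\<bar> \<le> D + real_of_int (b\<^sup>2 * c'\<^sup>2)" by linarith
    also have "real_of_int (b\<^sup>2 * c'\<^sup>2) = (real_of_int b)\<^sup>2 * \<bar>real_of_int c'\<bar>\<^sup>2" by simp
    also have "\<dots> \<le> (real_of_int b)\<^sup>2 * \<bar>real_of_int b\<bar>\<^sup>2"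
    proof -
      have "\<bar>real_of_int c'\<bar> \<le> \<bar>real_of_int b\<bar>" using k unfolding c'_def by linarith
      then show ?thesis by (intro mult_left_mono power_mono) auto
    qed
    also have "\<dots> \<le> Y * Y" using bd(4) Y Y1 by (intro mult_mono) auto
    also have "\<dots> = 5184 * D" using YD by (simp add: power2_eq_square)
    finally have "\<bar>real_of_int (b ^ 3 * d')\<bar> \<le> 1297 * D" using D(1) by linarith
    then have "subst_form F (u, v') \<in> reps D"
      using bd(4) Y b0 k unfolding eq reps_def Y_def c'_def[symmetric] by auto
    with \<open>(u, v') \<in> SL2\<close> show ?thesis by (rule that)
  qed
qed

lemma ln_le_of_two_power:
  fixes x :: real
  assumes "0 < x" "x \<le> 2 ^ n"
  shows "ln x \<le> real n"
proof -
  have "ln x \<le> real n * ln 2" using assms ln_le_cancel_iff[of x "2 ^ n"] by (simp add: ln_realpow)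
  also have "\<dots> \<le> real n * 1" using ln_le_minus_one[of "2::real"] by (intro mult_left_mono) auto
  finally show ?thesis by simp
qed

lemma card_reps_le:
  assumes D: "D \<ge> 1"
  shows "finite (reps D) \<and> real (card (reps D)) \<le> 27341856 * (D * (1 + ln D)\<^sup>2)"
proof -
  define Y where "Y = 72 * sqrt D"
  \<comment> \<open>4000 exceeds 72 + 3 * 1297 = 3963, the constant in the product bound for the
    encoded pairs of \<open>B\<close>.\<close>
  define W where "W = 4000 * D"
  define A where "A = {(a, b, c, d). (a, d) \<in> hyperbolic_pairs Y \<and> (b, c) \<in> hyperbolic_pairs Y}"
  define B where "B = {(a, b, c, d). (a :: int) = 0 \<and> b \<noteq> 0 \<and> \<bar>c\<bar> \<le> \<bar>b\<bar> \<and> (real_of_int b)\<^sup>2 \<le> Y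
          \<and> \<bar>real_of_int (b ^ 3 * d)\<bar> \<le> 1297 * D}"
  have AB: "reps D = A \<union> B" by (auto simp: reps_def A_def B_def Y_def)
  have s1: "sqrt D \<ge> 1" using D by simp
  then have Y1: "Y \<ge> 1" unfolding Y_def by linarith
  have W1: "W \<ge> 1" using D by (simp add: W_def)
  have l0: "ln D \<ge> 0" using D by simp
  have YW: "Y \<le> 72 * D"
  proof -
    have "sqrt D * 1 \<le> sqrt D * sqrt D" using s1 by (intro mult_left_mono) auto
    then show ?thesis using D by (simp add: Y_def)
  qed
  let ?h = "\<lambda>(a, b, c, d). ((a, d), (b, c)) :: (int \<times> int) \<times> (int \<times> int)"
  have injA: "inj_on ?h A" by (auto simp: inj_on_def)
  have subA: "?h ` A \<subseteq> hyperbolic_pairs Y \<times> hyperbolic_pairs Y" by (auto simp: A_def)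
  have finA: "finite A"
    by (rule finite_imageD[OF finite_subset[OF subA] injA]) (simp add: finite_hyperbolic_pairs)
  have "card A \<le> card (hyperbolic_pairs Y \<times> hyperbolic_pairs Y)"
    using card_inj_on_le[OF injA subA] finite_hyperbolic_pairs by simp
  then have "real (card A) \<le> (real (card (hyperbolic_pairs Y)))\<^sup>2"
    by (simp add: card_cartesian_product power2_eq_square flip: of_nat_mult)
  also have "\<dots> \<le> (9 * (Y * (1 + ln Y)))\<^sup>2"
    using card_hyperbolic_pairs_le[OF Y1] by (intro power_mono) auto
  also have "\<dots> \<le> (9 * (Y * (8 * (1 + ln D))))\<^sup>2"
  proof -
    have "ln Y = ln 72 + ln D / 2" using D by (simp add: Y_def ln_mult ln_sqrt)
    moreover have "ln (72::real) \<le> 7" using ln_le_of_two_power[of 72 7] by simp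
    ultimately have "1 + ln Y \<le> 8 * (1 + ln D)" using l0 by simp
    then show ?thesis using Y1 by (intro power_mono mult_left_mono) auto
  qed
  also have "\<dots> = 26873856 * (D * (1 + ln D)\<^sup>2)"
    unfolding power_mult_distrib Y_def using D by simp
  finally have cA: "real (card A) \<le> 26873856 * (D * (1 + ln D)\<^sup>2)" .
  \<comment> \<open>\<open>c\<close> and \<open>d\<close> are recovered from the second entry as balanced remainder and quotient modulo \<open>2 * \<bar>b\<bar> + 1\<close>.\<close>
  let ?k = "\<lambda>(a :: int, b, c, d). (b, c + (2 * \<bar>b\<bar> + 1) * d) :: int \<times> int"
  have injB: "inj_on ?k B"
  proof (rule inj_onI)
    fix x y assume x: "x \<in> B" and y: "y \<in> B" and e: "?k x = ?k y"
    obtain b c d where X: "x = (0, b, c, d)" "\<bar>c\<bar> \<le> \<bar>b\<bar>" using x by (auto simp: B_def)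
    obtain c' d' where Y: "y = (0, b, c', d')" "\<bar>c'\<bar> \<le> \<bar>b\<bar>" using y e X by (auto simp: B_def)
    have e': "c - c' = (2 * \<bar>b\<bar> + 1) * (d' - d)" using e by (simp add: X Y algebra_simps)
    have "d' - d = 0"
    proof (rule ccontr)
      assume "d' - d \<noteq> 0"
      then have "(2 * \<bar>b\<bar> + 1) * 1 \<le> (2 * \<bar>b\<bar> + 1) * \<bar>d' - d\<bar>" by (intro mult_left_mono) auto
      also have "\<dots> = \<bar>c - c'\<bar>" unfolding e' by (simp add: abs_mult)
      finally show False using X(2) Y(2) abs_triangle_ineq4[of c c'] by simp
    qed
    then show "x = y" using e' X Y by simp
  qed
  \<comment> \<open>The second entry is at most |b| + 3|b d|, so its product with b is at most b^2 +
    3 b^2 |d|. Both terms are O(D), since b^2 <= Y and b^2 |d| <= |b^3 d|.\<close>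
  have subB: "?k ` B \<subseteq> hyperbolic_pairs W"
  proof
    fix z assume "z \<in> ?k ` B"
    then obtain b c d where z: "z = (b, c + (2 * \<bar>b\<bar> + 1) * d)" and b: "b \<noteq> 0" "\<bar>c\<bar> \<le> \<bar>b\<bar>"
      "(real_of_int b)\<^sup>2 \<le> Y" "\<bar>real_of_int (b ^ 3 * d)\<bar> \<le> 1297 * D"
      by (auto simp: B_def)
    define x y where "x = real_of_int b" and "y = real_of_int d"
    have x1: "\<bar>x\<bar> \<ge> 1" using b(1) by (simp add: x_def)
    have c: "\<bar>real_of_int c\<bar> \<le> \<bar>x\<bar>" using b(2) by (simp add: x_def)
    have xx: "\<bar>x\<bar> \<le> \<bar>x\<bar> * \<bar>x\<bar>" using x1 mult_left_mono[of 1 "\<bar>x\<bar>" "\<bar>x\<bar>"] by simp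
    have xY: "\<bar>x\<bar> * \<bar>x\<bar> \<le> 72 * D" using b(3) YW by (simp add: x_def power2_eq_square)
    have cub: "\<bar>x\<bar> * \<bar>x\<bar> * (\<bar>x\<bar> * \<bar>y\<bar>) \<le> 1297 * D"
      using b(4) by (simp add: x_def y_def abs_mult power_abs power3_eq_cube mult_ac)
    have 1: "\<bar>x\<bar> * (\<bar>x\<bar> * \<bar>y\<bar>) \<le> 1297 * D"
    proof -
      have "\<bar>x\<bar> * (\<bar>x\<bar> * \<bar>y\<bar>) \<le> \<bar>x\<bar> * \<bar>x\<bar> * (\<bar>x\<bar> * \<bar>y\<bar>)" using xx by (intro mult_right_mono) auto
      then show ?thesis using cub by linarith
    qed
    have 2: "\<bar>x\<bar> * \<bar>y\<bar> \<le> \<bar>x\<bar> * (\<bar>x\<bar> * \<bar>y\<bar>)"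
      using x1 mult_right_mono[of 1 "\<bar>x\<bar>" "\<bar>x\<bar> * \<bar>y\<bar>"] by simp
    have 3: "\<bar>y\<bar> \<le> \<bar>x\<bar> * \<bar>y\<bar>" using x1 mult_right_mono[of 1 "\<bar>x\<bar>" "\<bar>y\<bar>"] by simp
    define t where "t = real_of_int (c + (2 * \<bar>b\<bar> + 1) * d)"
    have "\<bar>t\<bar> \<le> \<bar>real_of_int c\<bar> + \<bar>(2 * \<bar>x\<bar> + 1) * y\<bar>"
      unfolding t_def x_def y_def by simp
    also have "\<bar>(2 * \<bar>x\<bar> + 1) * y\<bar> = 2 * (\<bar>x\<bar> * \<bar>y\<bar>) + \<bar>y\<bar>"
      unfolding abs_mult by (subst abs_of_nonneg) (simp_all add: algebra_simps)
    finally have t: "\<bar>t\<bar> \<le> \<bar>x\<bar> + 3 * (\<bar>x\<bar> * \<bar>y\<bar>)" using c 3 by linarith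
    have "\<bar>x * t\<bar> \<le> \<bar>x\<bar> * (\<bar>x\<bar> + 3 * (\<bar>x\<bar> * \<bar>y\<bar>))"
      unfolding abs_mult using t by (intro mult_left_mono) auto
    also have "\<dots> = \<bar>x\<bar> * \<bar>x\<bar> + 3 * (\<bar>x\<bar> * (\<bar>x\<bar> * \<bar>y\<bar>))" by (simp add: algebra_simps)
    finally have "\<bar>x * t\<bar> \<le> W" using xY 1 D unfolding W_def by linarith
    moreover have "\<bar>t\<bar> \<le> W" using t 1 2 xx xY D unfolding W_def by linarith
    moreover have "\<bar>x\<bar> \<le> W" using xx xY D unfolding W_def by linarith
    ultimately show "z \<in> hyperbolic_pairs W"
      unfolding z hyperbolic_pairs_def t_def x_def by simp
  qed
  have finB: "finite B"
    by (rule finite_imageD[OF finite_subset[OF subB finite_hyperbolic_pairs] injB])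
  have "real (card B) \<le> real (card (hyperbolic_pairs W))"
    using card_inj_on_le[OF injB subB finite_hyperbolic_pairs] by simp
  also have "\<dots> \<le> 9 * (W * (1 + ln W))" using card_hyperbolic_pairs_le[OF W1] .
  also have "\<dots> \<le> 9 * (W * (13 * (1 + ln D)))"
  proof -
    have "ln W = ln 4000 + ln D" using D by (simp add: W_def ln_mult)
    moreover have "ln (4000::real) \<le> 12" using ln_le_of_two_power[of 4000 12] by simp
    ultimately have "1 + ln W \<le> 13 * (1 + ln D)" using l0 by simp
    then show ?thesis using W1 by (intro mult_left_mono) auto
  qed
  also have "\<dots> = 468000 * (D * (1 + ln D))" by (simp add: W_def)
  also have "\<dots> \<le> 468000 * (D * (1 + ln D)\<^sup>2)"
    using D l0 self_le_power[of "1 + ln D" 2] by (intro mult_left_mono) auto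
  finally have cB: "real (card B) \<le> 468000 * (D * (1 + ln D)\<^sup>2)" .
  have "real (card (reps D)) \<le> real (card A) + real (card B)"
    unfolding AB using card_Un_le[of A B] by (simp flip: of_nat_add)
  then show ?thesis using cA cB finA finB by (simp add: AB)
qed

section \<open>Counting in dyadic ranges of the discriminant\<close>

fun coeffs_le :: "real \<Rightarrow> int \<times> int \<times> int \<times> int \<Rightarrow> bool" where
  "coeffs_le H (a, b, c, d) \<longleftrightarrow> \<bar>real_of_int a\<bar> \<le> H \<and> \<bar>real_of_int b\<bar> \<le> H
     \<and> \<bar>real_of_int c\<bar> \<le> H \<and> \<bar>real_of_int d\<bar> \<le> H"

definition cubic_forms :: "real \<Rightarrow> (int \<times> int \<times> int \<times> int) set" where
  "cubic_forms H = {F. fst F \<noteq> 0 \<and> coeffs_le H F \<and> cubic_disc F \<noteq> 0}"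

lemma finite_cubic_forms: "finite (cubic_forms H)"
proof (rule finite_subset)
  let ?I = "{- \<lfloor>H\<rfloor>..\<lfloor>H\<rfloor>}"
  have i: "x \<in> ?I" if "\<bar>real_of_int x\<bar> \<le> H" for x
    using that by (auto; linarith)
  show "cubic_forms H \<subseteq> ?I \<times> ?I \<times> ?I \<times> ?I"
    unfolding cubic_forms_def using i by (auto simp del: atLeastAtMost_iff)
qed auto

text \<open>54 = 1 + 4 + 4 + 27 + 18. The bound allows log D to be replaced by log H in a nonempty
  shell.\<close>

lemma abs_cubic_disc_le:
  assumes "coeffs_le H F"
  shows "\<bar>real_of_int (cubic_disc F)\<bar> \<le> 54 * H ^ 4"
proof -
  obtain a b c d where F: "F = (a, b, c, d)" by (cases F)
  define A B C D where "A = \<bar>real_of_int a\<bar>" "B = \<bar>real_of_int b\<bar>" "C = \<bar>real_of_int c\<bar>" "D = \<bar>real_of_int d\<bar>"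
  note defs = A_B_C_D_def
  have le: "A \<le> H" "B \<le> H" "C \<le> H" "D \<le> H" using assms by (auto simp: F defs)
  have nn: "0 \<le> A" "0 \<le> B" "0 \<le> C" "0 \<le> D" by (auto simp: defs)
  have m: "w * x * y * z \<le> H * H * H * H"
    if "w \<in> {A, B, C, D}" "x \<in> {A, B, C, D}" "y \<in> {A, B, C, D}" "z \<in> {A, B, C, D}" for w x y z
    using that le nn by (intro mult_mono) auto
  have "\<bar>real_of_int (cubic_disc F)\<bar> \<le> B * B * C * C + 4 * (A * C * C * C) + 4 * (B * B * B * D)
      + 27 * (A * A * D * D) + 18 * (A * B * C * D)"
  proof -
    have "real_of_int (cubic_disc F) = real_of_int b * b * c * c - 4 * (real_of_int a * c * c * c)
       - 4 * (real_of_int b * b * b * d) - 27 * (real_of_int a * a * d * d) + 18 * (real_of_int a * b * c * d)"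
      by (simp add: F power2_eq_square power3_eq_cube)
    then have "\<bar>real_of_int (cubic_disc F)\<bar> \<le> \<bar>real_of_int b * b * c * c\<bar> + 4 * \<bar>real_of_int a * c * c * c\<bar>
       + 4 * \<bar>real_of_int b * b * b * d\<bar> + 27 * \<bar>real_of_int a * a * d * d\<bar> + 18 * \<bar>real_of_int a * b * c * d\<bar>"
      by linarith
    then show ?thesis by (simp only: abs_mult defs)
  qed
  also have "\<dots> \<le> H * H * H * H + 4 * (H * H * H * H) + 4 * (H * H * H * H)
      + 27 * (H * H * H * H) + 18 * (H * H * H * H)"
    by (intro add_mono mult_left_mono m) auto
  also have "\<dots> = 54 * H ^ 4" by (simp add: power4_eq_xxxx)
  finally show ?thesis .
qed

text \<open>Inside a shell \<kappa> is comparable to D^(1/6), so one bound for the number of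
  substitutions serves all representatives. Each form of the shell is its representative composed
  with an inverse substitution.\<close>

lemma card_shell_le:
  assumes H: "H \<ge> 1" and D: "D \<ge> 1"
  defines "S \<equiv> {F \<in> cubic_forms H. D / 2 < \<bar>real_of_int (cubic_disc F)\<bar> \<and> \<bar>real_of_int (cubic_disc F)\<bar> \<le> D}"
  shows "real (card S) \<le> real (card (reps D)) * (1335840 * (H powr (2/3) * (1 + ln H) * D powr (-1/6)))"
proof -
  define K where "K = 1335840 * (H powr (2/3) * (1 + ln H) * D powr (-1/6))"
  \<comment> \<open>\<open>reps D\<close> also contains forms of smaller discriminant, for which the
    bound on the number of substitutions would be too weak. The factorisation is part of the
    condition because \<open>balanced_factors_exist\<close> needs a nonzero leading coefficient;
    here it is carried over from the form in \<open>S\<close>.\<close>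
  define R where "R = {f \<in> reps D. \<exists>p r \<kappa>. factors f p r \<and> balanced p r \<kappa> \<and> \<kappa> > 0 \<and> D / 2 < \<kappa> ^ 6 \<and> \<kappa> \<ge> 1}"
  define G where "G f = {g \<in> SL2. coeffs_le H (subst_form f g)}" for f
  have fR: "finite R" using card_reps_le[OF D] by (simp add: R_def)
  have G: "finite (G f) \<and> real (card (G f)) \<le> K" if fR': "f \<in> R" for f
  proof -
    obtain p r \<kappa> where f: "factors f p r" "balanced p r \<kappa>" "\<kappa> > 0" "D / 2 < \<kappa> ^ 6" "\<kappa> \<ge> 1"
      using fR' by (auto simp: R_def)
    let ?X = "{(u, v). (u, v) \<in> SL2 \<and> linmax p r u v 0 * linmax p r u v 1 * linmax p r u v 2 \<le> 108 * H}"
    have X: "finite ?X" "real (card ?X) \<le> 667920 * (H powr (2/3) * (1 + ln H) / \<kappa>)"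
      using card_SL2_le[OF f(2) f(5) H] by auto
    have sub: "G f \<subseteq> ?X"
    proof
      fix g assume g: "g \<in> G f"
      obtain u v where uv: "g = (u, v)" by (cases g)
      obtain a b c d where s: "subst_form f (u, v) = (a, b, c, d)" by (cases "subst_form f (u, v)")
      show "g \<in> ?X"
        using g prod_linmax_le[OF f(1) s, of H] by (auto simp: G_def uv s)
    qed
    have "D \<le> 2 * \<kappa> ^ 6" using f(4) by simp
    also have "\<dots> \<le> (2 * \<kappa>) ^ 6" using f(3) by (simp add: power_mult_distrib)
    finally have "D powr (1/6) \<le> ((2 * \<kappa>) ^ 6) powr (1/6)" using D by (intro powr_mono2) auto
    also have "\<dots> = 2 * \<kappa>"
    proof -
      have "(2 * \<kappa>) ^ 6 = (2 * \<kappa>) powr real 6" using f(3) by (intro powr_realpow[symmetric]) auto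
      then show ?thesis using f(3) by (simp only: powr_powr) simp
    qed
    finally have "D powr (1/6) \<le> 2 * \<kappa>" .
    then have "1 / \<kappa> \<le> 2 * (1 / D powr (1/6))" using f(3) D by (simp add: field_simps)
    also have "1 / D powr (1/6) = D powr (-1/6)" using powr_minus_divide[of D "1/6"] by simp
    finally have k: "1 / \<kappa> \<le> 2 * D powr (-1/6)" .
    have "real (card (G f)) \<le> real (card ?X)" using card_mono[OF X(1) sub] by simp
    also have "\<dots> \<le> 667920 * (H powr (2/3) * (1 + ln H) * (1 / \<kappa>))" using X(2) by simp
    also have "\<dots> \<le> 667920 * (H powr (2/3) * (1 + ln H) * (2 * D powr (-1/6)))"
      using H k by (intro mult_left_mono) auto
    also have "\<dots> = K" by (simp add: K_def)
    finally show ?thesis using finite_subset[OF sub X(1)] by simp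
  qed
  have "S \<subseteq> (\<Union>f\<in>R. subst_form f ` G f)"
  proof
    fix F assume F: "F \<in> S"
    obtain a b c d where abcd: "F = (a, b, c, d)" by (cases F)
    have F': "a \<noteq> 0" "cubic_disc F \<noteq> 0" "coeffs_le H F" "D / 2 < \<bar>real_of_int (cubic_disc F)\<bar>"
      "\<bar>real_of_int (cubic_disc F)\<bar> \<le> D"
      using F by (auto simp: S_def cubic_forms_def abcd simp del: cubic_disc.simps)
    obtain p r \<kappa> where f: "factors F p r" "balanced p r \<kappa>" "\<kappa> > 0" "hprod p r \<in> \<real>"
      using balanced_factors_exist[OF F'(1) F'(2)[unfolded abcd]] unfolding abcd .
    have \<kappa>6: "\<bar>real_of_int (cubic_disc F)\<bar> = \<kappa> ^ 6" using abs_cubic_disc_balanced[OF f(1,2)] by simp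
    have "1 \<le> \<bar>cubic_disc F\<bar>" using F'(2) by linarith
    then have "1 \<le> \<kappa> ^ 6" unfolding \<kappa>6[symmetric] by linarith
    then have \<kappa>1: "\<kappa> \<ge> 1" using f(3) power_less_one_iff[of \<kappa> 6] by (simp add: not_less[symmetric])
    obtain u v where g: "(u, v) \<in> SL2" "subst_form F (u, v) \<in> reps D"
      using rep_exists[OF f D] F'(5) \<kappa>6 by (metis surj_pair)
    let ?g = "((snd v, - snd u), (- fst v, fst u))"
    have "factors (subst_form F (u, v)) (lin p r u) (lin p r v)" using factors_subst_form[OF f(1)] .
    then have "subst_form F (u, v) \<in> R"
      unfolding R_def using g balanced_lin[OF f(2) g(1)] f(3) \<kappa>1 F'(4) unfolding \<kappa>6
      by (intro CollectI conjI exI[of _ "lin p r u"] exI[of _ "lin p r v"] exI[of _ \<kappa>])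
    moreover have inv: "F = subst_form (subst_form F (u, v)) ?g" "?g \<in> SL2"
      using subst_form_inverse[OF f(1) g(1)] by simp_all
    moreover have "?g \<in> G (subst_form F (u, v))"
      unfolding G_def mem_Collect_eq inv(1)[symmetric] using inv(2) F'(3) by simp
    ultimately show "F \<in> (\<Union>f\<in>R. subst_form f ` G f)" by blast
  qed
  then have "card S \<le> card (\<Union>f\<in>R. subst_form f ` G f)"
    using fR G by (intro card_mono) auto
  also have "\<dots> \<le> (\<Sum>f\<in>R. card (G f))"
    using fR G by (intro order_trans[OF card_UN_le] sum_mono card_image_le) auto
  finally have "real (card S) \<le> (\<Sum>f\<in>R. real (card (G f)))" by (simp flip: of_nat_sum)
  also have "\<dots> \<le> (\<Sum>f\<in>R. K)" using G by (intro sum_mono) auto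
  also have "\<dots> = real (card R) * K" by simp
  also have "\<dots> \<le> real (card (reps D)) * K"
  proof (intro mult_right_mono)
    show "real (card R) \<le> real (card (reps D))"
      using card_reps_le[OF D] by (intro of_nat_mono card_mono) (auto simp: R_def)
    show "0 \<le> K" using H by (simp add: K_def)
  qed
  finally show ?thesis unfolding K_def .
qed

text \<open>A nonempty shell has D <= 108 H^4, hence 1 + ln D <= 8 (1 + ln H). The two logarithms of
  the class count join the one from the dyadic scales, which explains the cube and the factor
  64.\<close>

lemma card_shell_uniform_le:
  obtains C where "C \<ge> 0" "\<And>H D. H \<ge> 1 \<Longrightarrow> D \<ge> 1 \<Longrightarrow>
    real (card {F \<in> cubic_forms H. D / 2 < \<bar>real_of_int (cubic_disc F)\<bar> \<and> \<bar>real_of_int (cubic_disc F)\<bar> \<le> D})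
    \<le> C * (H powr (2/3) * (1 + ln H) ^ 3 * D powr (5/6))"
proof
  define c1 c2 :: real where "c1 = 27341856" and "c2 = 1335840"
  show "c1 * 64 * c2 \<ge> 0" by (simp add: c1_def c2_def)
  fix H D :: real assume H: "H \<ge> 1" and D: "D \<ge> 1"
  let ?S = "{F \<in> cubic_forms H. D / 2 < \<bar>real_of_int (cubic_disc F)\<bar> \<and> \<bar>real_of_int (cubic_disc F)\<bar> \<le> D}"
  have lH: "ln H \<ge> 0" and lD: "ln D \<ge> 0" using H D by auto
  show "real (card ?S) \<le> c1 * 64 * c2 * (H powr (2/3) * (1 + ln H) ^ 3 * D powr (5/6))"
  proof (cases "?S = {}")
    case True
    show ?thesis unfolding True using lH by (simp add: c1_def c2_def)
  next
    case False
    then obtain F where F: "coeffs_le H F" "D / 2 < \<bar>real_of_int (cubic_disc F)\<bar>"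
      by (auto simp: cubic_forms_def)
    then have "D \<le> 108 * H ^ 4" using abs_cubic_disc_le[OF F(1)] by simp
    then have "ln D \<le> ln (108 * H ^ 4)" by (subst ln_le_cancel_iff) (use D H in auto)
    also have "\<dots> = ln 108 + 4 * ln H" using H by (simp add: ln_mult ln_realpow)
    also have "ln (108 :: real) \<le> 7" using ln_le_of_two_power[of 108 7] by simp
    finally have "1 + ln D \<le> 8 * (1 + ln H)" using lH by simp
    then have sq: "(1 + ln D)\<^sup>2 \<le> (8 * (1 + ln H))\<^sup>2" using lD by (intro power_mono) auto
    define E where "E = H powr (2/3) * (1 + ln H) * D powr (-1/6)"
    have E: "E \<ge> 0" using lH by (simp add: E_def)
    have "real (card ?S) \<le> real (card (reps D)) * (c2 * E)"
      using card_shell_le[OF H D] by (simp add: c2_def E_def)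
    also have "\<dots> \<le> c1 * (D * (1 + ln D)\<^sup>2) * (c2 * E)"
      using card_reps_le[OF D] E by (intro mult_right_mono) (auto simp: c1_def c2_def)
    also have "\<dots> \<le> c1 * (D * (8 * (1 + ln H))\<^sup>2) * (c2 * E)"
      using sq E D by (intro mult_right_mono mult_left_mono) (auto simp: c1_def c2_def)
    also have "\<dots> = c1 * 64 * c2 * (H powr (2/3) * (1 + ln H) ^ 3 * (D * D powr (-1/6)))"
      unfolding E_def power_mult_distrib by (simp add: power2_eq_square power3_eq_cube)
    also have "D * D powr (-1/6) = D powr (5/6)"
      using D powr_add[of D 1 "-1/6"] by simp
    finally show ?thesis .
  qed
qed

text \<open>Halving D splits off one shell. Since (1/2)^(5/6) <= 2/3, the constant 3C reproduces
  itself: 3C * 2/3 + C = 3C. The recursion stops at D < 1, because a nonzero integer discriminant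
  has absolute value at least 1.\<close>

lemma card_cubic_forms_le:
  obtains C where "C \<ge> 0" "\<And>H D. H \<ge> 1 \<Longrightarrow> D > 0 \<Longrightarrow>
    real (card {F \<in> cubic_forms H. \<bar>real_of_int (cubic_disc F)\<bar> \<le> D})
    \<le> C * (H powr (2/3) * (1 + ln H) ^ 3 * D powr (5/6))"
proof -
  obtain C where C0: "C \<ge> 0" and C: "\<And>H D. H \<ge> 1 \<Longrightarrow> D \<ge> 1 \<Longrightarrow>
    real (card {F \<in> cubic_forms H. D / 2 < \<bar>real_of_int (cubic_disc F)\<bar> \<and> \<bar>real_of_int (cubic_disc F)\<bar> \<le> D})
    \<le> C * (H powr (2/3) * (1 + ln H) ^ 3 * D powr (5/6))"
    using card_shell_uniform_le by blast
  define T where "T H D = {F \<in> cubic_forms H. \<bar>real_of_int (cubic_disc F)\<bar> \<le> D}" for H D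
  define E where "E H = H powr (2/3) * (1 + ln H) ^ 3" for H :: real
  have fT: "finite (T H D)" for H D using finite_cubic_forms[of H] by (simp add: T_def)
  have small: "T H D = {}" if "D < 1" for H D
    using that by (auto simp: T_def cubic_forms_def simp del: cubic_disc.simps)
  have two: "(1/2 :: real) powr (5/6) \<le> 2/3"
  proof -
    have "((1/2 :: real) powr (5/6)) ^ 6 = (1/2) powr (5/6 * 6)"
      using powr_realpow[of "(1/2 :: real) powr (5/6)" 6] by (simp add: powr_powr)
    also have "\<dots> = (1/2) powr real 5" by simp
    also have "\<dots> = (1/2) ^ 5" by (rule powr_realpow) simp
    also have "\<dots> \<le> (2/3 :: real) ^ 6" by (simp add: power_divide)
    finally show ?thesis by (rule power_le_imp_le_base[where n = 5, simplified]) simp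
  qed
  have main: "real (card (T H D)) \<le> 3 * C * (E H * D powr (5/6))"
    if H: "H \<ge> 1" and "0 < D" "D < 2 ^ n" for H D and n :: nat
    using that(2,3)
  proof (induction n arbitrary: D)
    case 0
    have E0: "E H \<ge> 0" using H by (simp add: E_def)
    from 0 show ?case using small[of D H] C0 E0 by simp
  next
    case (Suc n)
    have E0: "E H \<ge> 0" using H by (simp add: E_def)
    show ?case
    proof (cases "D < 1")
      case True
      then show ?thesis using small[of D H] C0 E0 by simp
    next
      case False
      let ?S = "{F \<in> cubic_forms H. D / 2 < \<bar>real_of_int (cubic_disc F)\<bar> \<and> \<bar>real_of_int (cubic_disc F)\<bar> \<le> D}"
      have "T H D \<subseteq> T H (D / 2) \<union> ?S" by (auto simp: T_def simp del: cubic_disc.simps)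
      then have "card (T H D) \<le> card (T H (D / 2)) + card ?S"
        using fT[of H "D / 2"] finite_cubic_forms[of H]
        by (intro order_trans[OF card_mono card_Un_le]) auto
      then have "real (card (T H D)) \<le> real (card (T H (D / 2))) + real (card ?S)" by linarith
      also have "\<dots> \<le> 3 * C * (E H * (D / 2) powr (5/6)) + C * (E H * D powr (5/6))"
        using Suc.IH[of "D / 2"] Suc.prems C[OF H, of D] False by (intro add_mono) (auto simp: E_def)
      also have "(D / 2) powr (5/6) = D powr (5/6) * (1/2) powr (5/6)"
        using Suc.prems by (simp add: powr_divide)
      also have "3 * C * (E H * (D powr (5/6) * (1/2) powr (5/6))) \<le> 3 * C * (E H * (D powr (5/6) * (2/3)))"
        using two C0 E0 by (intro mult_left_mono) auto
      finally show ?thesis by (simp add: algebra_simps)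
    qed
  qed
  show ?thesis
  proof
    show "3 * C \<ge> 0" using C0 by simp
    fix H D :: real assume H: "H \<ge> 1" and D: "D > 0"
    obtain n where "D < 2 ^ n" using real_arch_pow[of 2 D] by auto
    then show "real (card {F \<in> cubic_forms H. \<bar>real_of_int (cubic_disc F)\<bar> \<le> D})
      \<le> 3 * C * (H powr (2/3) * (1 + ln H) ^ 3 * D powr (5/6))"
      using main[OF H D] by (simp add: T_def E_def)
  qed
qed

section \<open>From cubic polynomials to binary cubic forms\<close>

lemma N_le_card_cubic_forms:
  "N H D \<le> card {F \<in> cubic_forms H. \<bar>real_of_int (cubic_disc F)\<bar> \<le> D}"
  unfolding N_def
proof (rule card_inj_on_le)
  let ?f = "\<lambda>P :: int poly. (coeff P 3, coeff P 2, coeff P 1, coeff P 0)"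
  have P: "P = [:coeff P 0, coeff P 1, coeff P 2, coeff P 3:]" if "degree P = 3" for P :: "int poly"
    using that by (intro poly_eqI) (auto simp: coeff_pCons numeral_eq_Suc coeff_eq_0 split: nat.splits)
  show "inj_on ?f (cubics H D)"
    by (rule inj_onI) (metis (mono_tags, lifting) P Pair_inject cubics_def mem_Collect_eq)
  show "?f ` cubics H D \<subseteq> {F \<in> cubic_forms H. \<bar>real_of_int (cubic_disc F)\<bar> \<le> D}"
  proof
    fix F assume "F \<in> ?f ` cubics H D"
    then obtain P where F: "F = ?f P" and deg: "degree P = 3" and ht: "real_of_int (height P) \<le> H"
      and disc: "0 < \<bar>discriminant P\<bar>" "real_of_int \<bar>discriminant P\<bar> \<le> D"
      by (auto simp: cubics_def)
    have a: "coeff P 3 \<noteq> 0" using deg leading_coeff_neq_0[of P] by force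
    have "\<bar>real_of_int (coeff P i)\<bar> \<le> H" if "i \<le> 3" for i
    proof -
      have "\<bar>coeff P i\<bar> \<le> height P"
        unfolding height_def using that deg by (intro Max_ge) auto
      then show ?thesis using ht by linarith
    qed
    then have "coeffs_le H F" by (simp add: F)
    moreover have "discriminant P = cubic_disc F"
      using discriminant_cubic[OF a, of "coeff P 0" "coeff P 1" "coeff P 2"] P[OF deg] by (simp add: F)
    ultimately show "F \<in> {F \<in> cubic_forms H. \<bar>real_of_int (cubic_disc F)\<bar> \<le> D}"
      using disc a by (auto simp: cubic_forms_def F simp del: cubic_disc.simps)
  qed
  show "finite {F \<in> cubic_forms H. \<bar>real_of_int (cubic_disc F)\<bar> \<le> D}"
    using finite_cubic_forms[of H] by simp
qed

theorem theorem4: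
  fixes \<epsilon> :: real
  assumes "\<epsilon> > 0"
  shows "\<exists>c::real. \<forall>H D::real. H > 0 \<longrightarrow> D > 0 \<longrightarrow>
    real (N H D) \<le> c * H powr (2/3 + \<epsilon>) * D powr (5/6)"
proof -
  obtain C where C0: "C \<ge> 0" and C: "\<And>H D. H \<ge> 1 \<Longrightarrow> D > 0 \<Longrightarrow>
    real (card {F \<in> cubic_forms H. \<bar>real_of_int (cubic_disc F)\<bar> \<le> D})
    \<le> C * (H powr (2/3) * (1 + ln H) ^ 3 * D powr (5/6))"
    using card_cubic_forms_le by blast
  \<comment> \<open>From ln H <= H^(\<epsilon>/3) / (\<epsilon>/3); the exponent \<epsilon>/3 is
    chosen because the logarithm appears cubed.\<close>
  define k where "k = 1 + 1 / (\<epsilon> / 3)"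
  have k0: "k \<ge> 0" using assms by (simp add: k_def)
  show ?thesis
  proof (intro exI allI impI)
    fix H D :: real assume "H > 0" and D: "D > 0"
    show "real (N H D) \<le> (C * k ^ 3) * H powr (2/3 + \<epsilon>) * D powr (5/6)"
    proof (cases "H < 1")
      \<comment> \<open>For H < 1 the nonzero integer leading coefficient cannot be at most H, so
        nothing is counted.\<close>
      case True
      have "F \<notin> cubic_forms H" for F
        using True by (cases F) (auto simp: cubic_forms_def simp del: cubic_disc.simps)
      then have "N H D = 0" using N_le_card_cubic_forms[of H D] by simp
      then show ?thesis using C0 k0 by simp
    next
      case False
      then have H: "H \<ge> 1" by simp
      have "ln H \<le> H powr (\<epsilon> / 3) / (\<epsilon> / 3)" using H assms by (intro ln_powr_bound) auto
      moreover have "1 \<le> H powr (\<epsilon> / 3)" using H assms by (intro ge_one_powr_ge_zero) auto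
      ultimately have "1 + ln H \<le> k * H powr (\<epsilon> / 3)" by (simp add: k_def algebra_simps)
      then have "(1 + ln H) ^ 3 \<le> (k * H powr (\<epsilon> / 3)) ^ 3" using H by (intro power_mono) auto
      also have "\<dots> = k ^ 3 * H powr \<epsilon>"
      proof -
        have "(H powr (\<epsilon> / 3)) ^ 3 = (H powr (\<epsilon> / 3)) powr real 3"
          using H by (intro powr_realpow[symmetric]) auto
        also have "\<dots> = H powr \<epsilon>" unfolding powr_powr by simp
        finally show ?thesis by (simp add: power_mult_distrib)
      qed
      finally have l: "(1 + ln H) ^ 3 \<le> k ^ 3 * H powr \<epsilon>" .
      have "real (N H D) \<le> real (card {F \<in> cubic_forms H. \<bar>real_of_int (cubic_disc F)\<bar> \<le> D})"
        using N_le_card_cubic_forms by (rule of_nat_mono)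
      also have "\<dots> \<le> C * (H powr (2/3) * (1 + ln H) ^ 3 * D powr (5/6))" using C[OF H D] .
      also have "\<dots> \<le> C * (H powr (2/3) * (k ^ 3 * H powr \<epsilon>) * D powr (5/6))"
        using l C0 by (intro mult_left_mono mult_right_mono) auto
      also have "\<dots> = (C * k ^ 3) * H powr (2/3 + \<epsilon>) * D powr (5/6)"
        by (simp add: powr_add mult_ac)
      finally show ?thesis .
    qed
  qed
qed

end
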